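(* Let $E$ be a $k$-dimensional linear subspace of $\mathbb{R}^n$ ($1\le k\le n$). For any $2\le p<\infty$, every $0\le\theta\le1$ and every $\lambda\ge0$, $$\mathbb{E}e^{-\lambda\|G\|_{E\cap B_p^n}^{\theta p}}\le\mathbb{E}e^{-\lambda(\sqrt{k/n})^{\theta(p-2)}\|G\|_{B_p^k}^{\theta p}}.$$ In particular, for every $0\le\beta\le p$, $$\mathbb{E}\|G\|_{E\cap B_p^n}^{\beta}\ge\left(\frac kn\right)^{\beta(1/2-1/p)}\mathbb{E}\|G\|_{B_p^k}^{\beta}.$$ Also, for every $0\le\alpha<k$, $$\mathbb{E}\|G\|_{E\cap B_p^n}^{-\alpha}\le\left(\frac nk\right)^{\alpha(1/2-1/p)}\mathbb{E}\|G\|_{B_p^k}^{-\alpha}.$$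
   Context: For $0<p<\infty$, $\|x\|_p=(\sum_i|x_i|^p)^{1/p}$. In expressions with $\|G\|_{E\cap B_p^n}$, $G$ is a standard Gaussian vector on the subspace $E$ and $\|G\|_{E\cap B_p^n}=\|G\|_p$ (the $\ell_p^n$ norm of $G\in E\subset\mathbb{R}^n$); in expressions with $\|G\|_{B_p^k}$, $G$ is a standard Gaussian vector in $\mathbb{R}^k$ and $\|G\|_{B_p^k}=\|G\|_p$ (the $\ell_p^k$ norm). *)

theory Defs
  imports "HOL-Probability.Probability"
begin

definition lp_norm :: "real \<Rightarrow> real ^ 'n \<Rightarrow> real" where
  "lp_norm p x = (\<Sum>i\<in>UNIV. \<bar>x $ i\<bar> powr p) powr (1 / p)"

definition orthonormal_basis_of :: "'a::euclidean_space set \<Rightarrow> 'a set \<Rightarrow> bool" where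
  "orthonormal_basis_of E B \<longleftrightarrow>
     pairwise orthogonal B \<and> (\<forall>b\<in>B. norm b = 1) \<and> span B = E"

text \<open>
  The law described here does not depend on the choice of the orthonormal basis, by rotation
  invariance.  For \<open>E = UNIV\<close> it is the standard Gaussian law of the whole space.
\<close>

definition std_gaussian_on :: "'w measure \<Rightarrow> 'a::euclidean_space set \<Rightarrow> ('w \<Rightarrow> 'a) \<Rightarrow> bool" where
  "std_gaussian_on M E G \<longleftrightarrow>
     prob_space M \<and> G \<in> borel_measurable M \<and> (AE \<omega> in M. G \<omega> \<in> E) \<and>
     (\<exists>B. orthonormal_basis_of E B \<and>
          prob_space.indep_vars M (\<lambda>_. borel) (\<lambda>b \<omega>. G \<omega> \<bullet> b) B \<and>
          (\<forall>b\<in>B. distributed M lborel (\<lambda>\<omega>. G \<omega> \<bullet> b) std_normal_density))"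

text \<open>
  Expectations of nonnegative random variables are taken as \<^const>\<open>nn_integral\<close>, with values
  in \<open>[0, \<infinity>]\<close>, so that no integrability is presupposed.  The value of \<open>0 powr a\<close>, which is \<open>0\<close>
  for every \<open>a\<close>, has no influence: on a subspace of positive dimension a standard Gaussian vector
  is almost surely nonzero.
\<close>

end

theory Submission
  imports Defs
begin

text \<open>
  Put \<open>X = \<parallel>G\<parallel>\<^sub>p\<^sup>p\<close>, \<open>q = (p - 2) / 2\<close> and \<open>Y = (k / n)\<^sup>q \<parallel>H\<parallel>\<^sub>p\<^sup>p\<close>.  Everything follows from the domination
  of Laplace transforms \<open>E exp (- t X) \<le> E exp (- t Y)\<close> for all \<open>t \<ge> 0\<close>, because \<open>x \<mapsto> exp (- t x\<^sup>\<theta>)\<close> and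
  \<open>x \<mapsto> x\<^sup>-\<^sup>a\<close> are mixtures of decaying exponentials.

  In orthonormal coordinates of \<open>E\<close>, the coordinates of \<open>G\<close> are inner products of a standard Gaussian
  vector of \<open>\<real>\<^sup>k\<close> with vectors \<open>w\<^sub>i\<close> forming a Parseval frame.  With \<open>c\<^sub>i = \<parallel>w\<^sub>i\<parallel>\<^sup>2\<close>, so that \<open>\<Sum> c\<^sub>i = k\<close>, and
  \<open>\<phi> t = E exp (- t \<bar>g\<bar>\<^sup>p)\<close> for a standard normal variable \<open>g\<close>, the geometric Brascamp-Lieb inequality gives
  \<open>E exp (- t X) \<le> \<Prod> \<phi> (t c\<^sub>i\<^sup>q) powr c\<^sub>i\<close>.  It is proved by Barthe's transport argument, which rests on
  the determinant inequality \<open>\<Prod> t\<^sub>i powr c\<^sub>i \<le> det (\<Sum> t\<^sub>i w\<^sub>i w\<^sub>i\<^sup>T)\<close>.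

  Finally \<open>\<Prod> \<phi> (t c\<^sub>i\<^sup>q) powr c\<^sub>i \<le> \<phi> (t (k / n)\<^sup>q) powr k\<close>, and the right-hand side is \<open>E exp (- t Y)\<close>.  This is a
  one-dimensional Prekopa argument, again by transport, based on the joint convexity of
  \<open>(s, u) \<mapsto> \<bar>u\<bar>\<^sup>p / s\<^sup>q\<close>, which holds since \<open>p \<ge> q + 1\<close>.
\<close>

section \<open>A determinant inequality\<close>

text \<open>Jensen's inequality for \<open>exp\<close> at the points \<open>ln (t i)\<close>. It
  bounds from below the eigenvalues in \<open>det_frame_operator_ge\<close> and the Jacobian in
  \<open>normal_laplace_prod_le\<close>.\<close>

lemma weighted_arith_geom_mean:
  fixes a t :: "'i \<Rightarrow> real"
  assumes I: "finite I" and a: "\<And>i. i \<in> I \<Longrightarrow> 0 \<le> a i" "sum a I = 1"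
    and t: "\<And>i. i \<in> I \<Longrightarrow> 0 < t i"
  shows "(\<Prod>i\<in>I. t i powr a i) \<le> (\<Sum>i\<in>I. a i * t i)"
proof -
  have "I \<noteq> {}"
    using a(2) by auto
  then have "exp (\<Sum>i\<in>I. a i *\<^sub>R ln (t i)) \<le> (\<Sum>i\<in>I. a i * exp (ln (t i)))"
    using I a by (intro convex_on_sum[OF _ _ exp_convex]) auto
  also have "\<dots> = (\<Sum>i\<in>I. a i * t i)"
    using t by (intro sum.cong) auto
  also have "exp (\<Sum>i\<in>I. a i *\<^sub>R ln (t i)) = (\<Prod>i\<in>I. t i powr a i)"
    using t I by (auto simp: exp_sum powr_def intro!: prod.cong) (metis less_irrefl)
  finally show ?thesis .
qed

section \<open>Diagonalization of self-adjoint maps\<close>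

lemma linear_le_quadratic_imp_zero:
  fixes b c :: real
  assumes "\<And>e. 2 * e * b \<le> e\<^sup>2 * c"
  shows "b = 0"
proof (rule ccontr)
  assume "b \<noteq> 0"
  define d where "d = \<bar>c\<bar> + 1"
  have d: "0 < d" "c < 2 * d"
    unfolding d_def by (auto simp: abs_real_def)
  \<comment> \<open>The step \<open>e = b / d\<close> is small enough for the linear term to win:
    \<open>d\<close> exceeds \<open>c / 2\<close>.\<close>
  have "2 * (b / d) * b \<le> (b / d)\<^sup>2 * c"
    by (rule assms)
  then have "2 * d * b\<^sup>2 \<le> c * b\<^sup>2"
    using d by (simp add: field_simps power2_eq_square)
  with d \<open>b \<noteq> 0\<close> show False
    by auto
qed

text \<open>A maximizer \<open>v\<close> of the Rayleigh quotient on the compact unit sphere of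
  \<open>S\<close> is an eigenvector: the first variation shows that \<open>f v\<close> has no
  component in \<open>S\<close> orthogonal to \<open>v\<close>.\<close>

lemma self_adjoint_eigenvector:
  fixes f :: "'a::euclidean_space \<Rightarrow> 'a"
  assumes lin: "linear f" and adj: "\<And>x y. f x \<bullet> y = x \<bullet> f y"
    and S: "subspace S" "f ` S \<subseteq> S" "S \<noteq> {0}"
  obtains v a where "v \<in> S" "norm v = 1" "f v = a *\<^sub>R v"
proof -
  obtain x where x: "x \<in> S" "x \<noteq> 0"
    using S subspace_0 by blast
  then have "x /\<^sub>R norm x \<in> S \<inter> sphere 0 1"
    using S by (simp add: subspace_scale)
  moreover have "compact (S \<inter> sphere 0 1)"
    using S by (intro closed_Int_compact closed_subspace) auto
  moreover have "continuous_on (S \<inter> sphere 0 1) (\<lambda>x. f x \<bullet> x)"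
    using lin by (intro continuous_intros linear_continuous_on) (simp add: linear_conv_bounded_linear)
  ultimately have "\<exists>v\<in>S \<inter> sphere 0 1. \<forall>x\<in>S \<inter> sphere 0 1. f x \<bullet> x \<le> f v \<bullet> v"
    by (intro continuous_attains_sup) blast+
  then obtain v where v: "v \<in> S" "norm v = 1"
    and max: "\<And>x. x \<in> S \<Longrightarrow> norm x = 1 \<Longrightarrow> f x \<bullet> x \<le> f v \<bullet> v"
    by auto
  define a where "a = f v \<bullet> v"
  have le: "f u \<bullet> u \<le> a * (u \<bullet> u)" if u: "u \<in> S" for u
  proof (cases "u = 0")
    case False
    have "f (u /\<^sub>R norm u) \<bullet> (u /\<^sub>R norm u) \<le> a"
      unfolding a_def using False u S by (intro max) (auto simp: subspace_scale)
    then have "(f u \<bullet> u) / (norm u)\<^sup>2 \<le> a"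
      by (simp add: linear_scale[OF lin] power2_eq_square divide_simps mult.commute)
    then show ?thesis
      using False by (simp add: divide_simps power2_norm_eq_inner)
  qed (simp add: linear_0[OF lin])
  \<comment> \<open>Perturb \<open>v\<close> to \<open>v + e *\<^sub>R w\<close>: by maximality the
    term linear in \<open>e\<close> is bounded by a quadratic one for all \<open>e\<close> of either
    sign, so it vanishes.\<close>
  have orth: "f v \<bullet> w = 0" if w: "w \<in> S" "w \<bullet> v = 0" for w
  proof (rule linear_le_quadratic_imp_zero)
    fix e :: real
    have "f (v + e *\<^sub>R w) \<bullet> (v + e *\<^sub>R w) \<le> a * ((v + e *\<^sub>R w) \<bullet> (v + e *\<^sub>R w))"
      using v w S by (intro le) (simp add: subspace_add subspace_scale)
    moreover have "v \<bullet> v = 1"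
      using v by (simp add: norm_eq_1)
    moreover have "f w \<bullet> v = f v \<bullet> w"
      by (subst adj) (rule inner_commute)
    ultimately show "2 * e * (f v \<bullet> w) \<le> e\<^sup>2 * (a * (w \<bullet> w) - f w \<bullet> w)"
      using w unfolding a_def
      by (simp add: linear_add[OF lin] linear_scale[OF lin] inner_add_left inner_add_right
          inner_commute[of v w] algebra_simps power2_eq_square)
  qed
  have vv: "v \<bullet> v = 1"
    using v by (simp add: norm_eq_1)
  \<comment> \<open>The residual is itself an admissible direction, so it is orthogonal to both
    \<open>f v\<close> and \<open>v\<close>, hence to itself.\<close>
  define w where "w = f v - a *\<^sub>R v"
  have w: "w \<in> S" "w \<bullet> v = 0"
    using v S vv by (auto simp: w_def a_def subspace_diff subspace_scale image_subset_iff inner_diff_left)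
  have "w \<bullet> w = f v \<bullet> w - a * (v \<bullet> w)"
    by (simp add: w_def inner_diff_left)
  then have "w \<bullet> w = 0"
    using orth[OF w] w by (simp add: inner_commute)
  then have "f v = a *\<^sub>R v"
    by (simp add: w_def)
  with v that show ?thesis
    by blast
qed

text \<open>Induction on \<open>dim S\<close>: split off a unit eigenvector \<open>v\<close>;
  self-adjointness keeps the orthogonal complement of \<open>v\<close> in \<open>S\<close>
  invariant.\<close>

lemma self_adjoint_eigenbasis:
  fixes f :: "'a::euclidean_space \<Rightarrow> 'a"
  assumes lin: "linear f" and adj: "\<And>x y. f x \<bullet> y = x \<bullet> f y"
    and S: "subspace S" "f ` S \<subseteq> S"
  shows "\<exists>B. pairwise orthogonal B \<and> (\<forall>b\<in>B. norm b = 1) \<and> span B = S \<and> (\<forall>b\<in>B. \<exists>a. f b = a *\<^sub>R b)"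
  using S
proof (induction "dim S" arbitrary: S)
  case 0
  then have "S = {0}"
    using dim_eq_0 subspace_0 by fastforce
  then show ?case
    by (intro exI[of _ "{}"]) auto
next
  case (Suc d)
  then have "S \<noteq> {0}"
    by auto
  then obtain v a where v: "v \<in> S" "norm v = 1" "f v = a *\<^sub>R v"
    by (rule self_adjoint_eigenvector[OF lin adj Suc.prems])
  then have vv: "v \<bullet> v = 1"
    by (simp add: norm_eq_1)
  define S' where "S' = {x \<in> S. x \<bullet> v = 0}"
  have sub: "subspace S'"
    using Suc.prems(1) by (auto simp: S'_def subspace_def inner_add_left)
  have "f ` S' \<subseteq> S'"
    using Suc.prems(2) v by (auto simp: S'_def adj)
  have "v \<notin> span S'"
    unfolding span_eq_iff[THEN iffD2, OF sub] by (simp add: S'_def vv)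
  have S_eq: "span (insert v S') = S"
  proof
    show "span (insert v S') \<subseteq> S"
      using v Suc.prems by (intro span_minimal) (auto simp: S'_def)
    show "S \<subseteq> span (insert v S')"
    proof
      fix x assume "x \<in> S"
      then have "x - (x \<bullet> v) *\<^sub>R v \<in> S'"
        using v vv Suc.prems by (auto simp: S'_def inner_diff_left subspace_diff subspace_scale)
      then have "(x - (x \<bullet> v) *\<^sub>R v) + (x \<bullet> v) *\<^sub>R v \<in> span (insert v S')"
        by (intro span_add span_scale) (auto intro: span_base)
      then show "x \<in> span (insert v S')"
        by simp
    qed
  qed
  have "dim S = Suc (dim S')"
    using \<open>v \<notin> span S'\<close> dim_insert[of v S'] dim_span[of "insert v S'"] unfolding S_eq by simp
  then have "d = dim S'"
    using Suc.hyps(2) by simp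
  then obtain B where B: "pairwise orthogonal B" "\<forall>b\<in>B. norm b = 1" "span B = S'"
    "\<forall>b\<in>B. \<exists>a. f b = a *\<^sub>R b"
    using Suc.hyps(1)[OF _ sub \<open>f ` S' \<subseteq> S'\<close>] by blast
  show ?case
  proof (intro exI conjI)
    have "orthogonal v b \<and> orthogonal b v" if "b \<in> B" for b
    proof -
      have "b \<in> S'"
        using that B(3) span_base by blast
      then show ?thesis
        by (auto simp: S'_def orthogonal_def inner_commute)
    qed
    then show "pairwise orthogonal (insert v B)"
      using B(1) by (auto simp: pairwise_insert)
    show "span (insert v B) = S"
      by (simp add: span_insert B(3) flip: S_eq)
        (simp add: span_eq_iff[THEN iffD2, OF sub])
  qed (use B v in auto)
qed

text \<open>The eigenvalues appear as \<open>f (v j) \<bullet> v j\<close> because the determinant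
  inequality compares these values directly; indexing by \<open>'m\<close> makes the eigenvectors
  the columns of a square matrix.\<close>

lemma self_adjoint_diagonalization:
  fixes f :: "real^'m \<Rightarrow> real^'m"
  assumes lin: "linear f" and adj: "\<And>x y. f x \<bullet> y = x \<bullet> f y"
  obtains v :: "'m \<Rightarrow> real^'m" where
    "\<And>x. (\<Sum>j\<in>UNIV. (v j \<bullet> x)\<^sup>2) = x \<bullet> x" "\<And>j. v j \<bullet> v j = 1"
    "det (matrix f) = (\<Prod>j\<in>UNIV. f (v j) \<bullet> v j)"
proof -
  obtain B where B: "pairwise orthogonal B" "\<forall>b\<in>B. norm b = 1" "span B = (UNIV :: (real^'m) set)"
    "\<forall>b\<in>B. \<exists>a. f b = a *\<^sub>R b"
    using self_adjoint_eigenbasis[OF lin adj, of UNIV] by auto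
  have indep: "independent B"
    using B by (intro pairwise_orthogonal_independent) auto
  then have "card B = CARD('m)"
    using B(3) dim_eq_card[of B "UNIV :: (real^'m) set"] by simp
  moreover have "finite B"
    using indep by (rule independent_imp_finite)
  ultimately obtain v :: "'m \<Rightarrow> real^'m" where v: "bij_betw v UNIV B"
    using finite_same_card_bij[of "UNIV :: 'm set" B] by auto
  have ortho: "v i \<bullet> v j = (if i = j then 1 else 0)" for i j
  proof -
    have "v i \<in> B" "v j \<in> B" "v i = v j \<longleftrightarrow> i = j"
      using v by (auto simp: bij_betw_def inj_on_def)
    then show ?thesis
      using B(1,2) by (auto simp: pairwise_def orthogonal_def norm_eq_1)
  qed
  have eig: "f (v j) = (f (v j) \<bullet> v j) *\<^sub>R v j" for j
  proof -
    have "v j \<in> B"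
      using v by (auto simp: bij_betw_def)
    then obtain a where "f (v j) = a *\<^sub>R v j"
      using B(4) by blast
    then show ?thesis
      using ortho[of j j] by simp
  qed
  define V where "V = (\<chi> i j. v j $ i)"
  define D where "D = (\<chi> i j. if i = j then f (v j) \<bullet> v j else 0)"
  have V: "transpose V ** V = mat 1"
    using ortho by (auto simp: V_def matrix_matrix_mult_def transpose_def mat_def vec_eq_iff inner_vec_def)
  then have V': "orthogonal_matrix V"
    by (simp add: orthogonal_matrix)
  have "det (transpose V ** V) = 1"
    using V by simp
  then have "det V \<noteq> 0"
    by (auto simp: det_mul)
  have "matrix f ** V = V ** D"
  proof -
    have "(matrix f ** V) $ i $ j = (V ** D) $ i $ j" for i j
    proof -
      have "(matrix f ** V) $ i $ j = (matrix f *v v j) $ i"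
        by (simp add: matrix_matrix_mult_def matrix_vector_mult_def V_def)
      also have "\<dots> = f (v j) $ i"
        using lin by (simp add: matrix_works linear_matrix_vector_mul_eq)
      also have "\<dots> = (f (v j) \<bullet> v j) * v j $ i"
        by (subst eig) simp
      also have "\<dots> = (V ** D) $ i $ j"
        by (simp add: matrix_matrix_mult_def V_def D_def if_distrib[of "\<lambda>x. _ * x"] sum.If_cases mult.commute cong: if_cong)
      finally show ?thesis .
    qed
    then show ?thesis
      by (simp add: vec_eq_iff)
  qed
  then have "det (matrix f) = det D"
    using \<open>det V \<noteq> 0\<close> by (metis det_mul mult.commute mult_cancel_left)
  also have "\<dots> = (\<Prod>j\<in>UNIV. f (v j) \<bullet> v j)"
    by (subst det_diagonal) (auto simp: D_def)
  finally have det: "det (matrix f) = (\<Prod>j\<in>UNIV. f (v j) \<bullet> v j)" .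
  have "(\<Sum>j\<in>UNIV. (v j \<bullet> x)\<^sup>2) = x \<bullet> x" for x
  proof -
    have "(\<Sum>j\<in>UNIV. (v j \<bullet> x)\<^sup>2) = (transpose V *v x) \<bullet> (transpose V *v x)"
      by (simp add: inner_vec_def matrix_vector_mult_def V_def transpose_def power2_eq_square)
    also have "\<dots> = x \<bullet> ((V ** transpose V) *v x)"
      by (metis dot_lmul_matrix inner_commute matrix_vector_mul_assoc transpose_matrix_vector transpose_transpose)
    also have "V ** transpose V = mat 1"
      using V' by (simp add: orthogonal_matrix_def)
    finally show ?thesis
      by simp
  qed
  with det show ?thesis
    by (intro that[of v]) (simp_all add: ortho)
qed

text \<open>In an orthonormal eigenbasis \<open>v\<close> of the frame operator, the eigenvalue at
  \<open>v j\<close> is the mean of the \<open>t i\<close> with weights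
  \<open>(v j \<bullet> w i)\<^sup>2\<close>, which sum to one over \<open>i\<close> by the frame
  identity. The arithmetic-geometric mean inequality applies to each eigenvalue, and the exponents
  summed over \<open>j\<close> give \<open>(norm (w i))\<^sup>2\<close> by Parseval.\<close>

lemma det_frame_operator_ge:
  fixes w :: "'i \<Rightarrow> real^'m"
  assumes I: "finite I" and frame: "\<And>x. (\<Sum>i\<in>I. (x \<bullet> w i)\<^sup>2) = x \<bullet> x"
    and t: "\<And>i. i \<in> I \<Longrightarrow> 0 < t i"
  shows "(\<Prod>i\<in>I. t i powr (norm (w i))\<^sup>2) \<le> det (matrix (\<lambda>x. \<Sum>i\<in>I. (t i * (x \<bullet> w i)) *\<^sub>R w i))"
proof -
  let ?f = "\<lambda>x. \<Sum>i\<in>I. (t i * (x \<bullet> w i)) *\<^sub>R w i"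
  have lin: "linear ?f"
    by (intro linearI) (simp_all add: inner_add_left algebra_simps sum.distrib scaleR_sum_right)
  have adj: "?f x \<bullet> y = x \<bullet> ?f y" for x y
    by (auto simp: inner_sum_left inner_sum_right inner_commute mult_ac intro!: sum.cong)
  obtain v :: "'m \<Rightarrow> real^'m" where
    pars: "\<And>x. (\<Sum>j\<in>UNIV. (v j \<bullet> x)\<^sup>2) = x \<bullet> x" and unit: "\<And>j. v j \<bullet> v j = 1"
    and det: "det (matrix ?f) = (\<Prod>j\<in>UNIV. ?f (v j) \<bullet> v j)"
    using self_adjoint_diagonalization[OF lin adj] by blast
  have "(\<Prod>i\<in>I. t i powr (norm (w i))\<^sup>2) = (\<Prod>i\<in>I. t i powr (\<Sum>j\<in>UNIV. (v j \<bullet> w i)\<^sup>2))"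
    by (simp add: pars power2_norm_eq_inner)
  also have "\<dots> = (\<Prod>i\<in>I. \<Prod>j\<in>UNIV. t i powr (v j \<bullet> w i)\<^sup>2)"
    using t by (intro prod.cong refl powr_sum) (metis less_irrefl)
  also have "\<dots> = (\<Prod>j\<in>UNIV. \<Prod>i\<in>I. t i powr (v j \<bullet> w i)\<^sup>2)"
    by (rule prod.swap)
  also have "\<dots> \<le> (\<Prod>j\<in>UNIV. \<Sum>i\<in>I. (v j \<bullet> w i)\<^sup>2 * t i)"
  proof (rule prod_mono, rule conjI)
    fix j
    show "0 \<le> (\<Prod>i\<in>I. t i powr (v j \<bullet> w i)\<^sup>2)"
      by (rule prod_nonneg) simp
    show "(\<Prod>i\<in>I. t i powr (v j \<bullet> w i)\<^sup>2) \<le> (\<Sum>i\<in>I. (v j \<bullet> w i)\<^sup>2 * t i)"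
      using I t by (intro weighted_arith_geom_mean) (simp_all add: frame unit)
  qed
  also have "\<dots> = (\<Prod>j\<in>UNIV. ?f (v j) \<bullet> v j)"
    by (simp add: inner_sum_left power2_eq_square inner_commute[of "w _" "v _"] mult_ac)
  finally show ?thesis
    unfolding det .
qed

section \<open>Transport on the line and substitution\<close>

text \<open>Positivity makes the distribution function strictly increasing, hence injective and
  never equal to 0 or 1; continuity makes it differentiable everywhere, and the intermediate value
  theorem gives the whole range.\<close>

lemma density_distribution_function:
  fixes f :: "real \<Rightarrow> real"
  assumes cont: "continuous_on UNIV f" and pos: "\<And>x. 0 < f x"
    and total: "(\<integral>\<^sup>+ x. ennreal (f x) \<partial>lborel) = 1"
  shows "\<exists>F. (\<forall>x. (F has_real_derivative f x) (at x)) \<and> inj F \<and> range F = {0<..<1}"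
proof -
  have [measurable]: "f \<in> borel_measurable borel"
    using cont by (rule borel_measurable_continuous_onI)
  define D where "D = density lborel (\<lambda>x. ennreal (f x))"
  interpret D: prob_space D
    by (rule prob_spaceI) (simp add: D_def emeasure_density total)
  interpret real_distribution D
    by unfold_locales (simp_all add: D_def)
  have diff: "cdf D y = cdf D a + integral {a..y} f" if "a \<le> y" for a y
  proof (cases "a = y")
    case False
    with that have "a < y"
      by simp
    have int: "(f has_integral integral {a..y} f) {a..y}"
      by (intro integrable_integral integrable_continuous_interval continuous_on_subset[OF cont]) simp
    have "emeasure D {a<..y} = (\<integral>\<^sup>+ x. ennreal (f x) * indicator {a..y} x \<partial>lborel)"
      unfolding D_def using AE_lborel_singleton[of a]
      by (subst emeasure_density) (auto intro!: nn_integral_cong_AE elim!: eventually_mono simp: indicator_def)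
    also have "\<dots> = ennreal (integral {a..y} f)"
      using int pos by (intro nn_integral_has_integral_lebesgue') (auto simp: less_imp_le)
    finally have "measure D {a<..y} = integral {a..y} f"
      using int pos by (intro measure_eq_emeasure_eq_ennreal has_integral_nonneg[OF int]) (auto simp: less_imp_le)
    then show ?thesis
      using cdf_diff_eq[OF \<open>a < y\<close>] by simp
  qed simp
  have deriv: "(cdf D has_real_derivative f x) (at x)" for x
  proof -
    \<comment> \<open>Starting the integral at \<open>x - 1\<close> makes \<open>x\<close> an
      interior point, so that the derivative within the interval is a full derivative.\<close>
    have "((\<lambda>y. cdf D (x - 1) + integral {x - 1..y} f) has_real_derivative f x) (at x within {x - 1..x + 1})"
      by (auto intro!: derivative_eq_intros integral_has_real_derivative continuous_on_subset[OF cont])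
    then have "((\<lambda>y. cdf D (x - 1) + integral {x - 1..y} f) has_real_derivative f x) (at x)"
      by (simp add: at_within_Icc_at)
    then show ?thesis
      by (rule has_field_derivative_transform_within_open[where S="{x - 1<..}"]) (simp_all flip: diff)
  qed
  have less: "cdf D x < cdf D y" if "x < y" for x y
    by (rule DERIV_pos_imp_increasing[OF that]) (use deriv pos in blast)
  have "inj (cdf D)"
    by (rule linorder_injI) (metis less less_irrefl)
  moreover have "range (cdf D) = {0<..<1}"
  proof safe
    fix x
    show "cdf D x \<in> {0<..<1}"
      using less[of "x - 1" x] less[of x "x + 1"] cdf_nonneg[of "x - 1"] cdf_bounded_prob[of "x + 1"] by simp
  next
    fix y :: real assume y: "y \<in> {0<..<1}"
    have "eventually (\<lambda>x. cdf D x < y) at_bot"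
      using y by (intro order_tendstoD(2)[OF cdf_lim_at_bot]) auto
    then obtain a where a: "cdf D a < y"
      by (auto simp: eventually_at_bot_linorder)
    have "eventually (\<lambda>x. y < cdf D x) at_top"
      using y by (intro order_tendstoD(1)[OF cdf_lim_at_top_prob]) auto
    then obtain b where b: "y < cdf D b"
      by (auto simp: eventually_at_top_linorder)
    have "a \<le> b"
      using a b cdf_nondecreasing[of b a] by linarith
    moreover have "continuous_on {a..b} (cdf D)"
      using deriv by (auto intro!: continuous_at_imp_continuous_on DERIV_isCont)
    ultimately obtain x where "cdf D x = y"
      using a b IVT'[of "cdf D" a y b] by auto
    then show "y \<in> range (cdf D)"
      by blast
  qed
  ultimately show ?thesis
    using deriv by blast
qed

text \<open>\<open>T = inv G \<circ> F\<close>, with the two distribution functions, carries the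
  density \<open>f\<close> to \<open>g\<close>. Only its differential equation, the one-dimensional
  Monge-Ampere equation, is used later.\<close>

lemma monotone_transport:
  fixes f g :: "real \<Rightarrow> real"
  assumes f: "continuous_on UNIV f" "\<And>x. 0 < f x" "(\<integral>\<^sup>+ x. ennreal (f x) \<partial>lborel) = 1"
    and g: "continuous_on UNIV g" "\<And>x. 0 < g x" "(\<integral>\<^sup>+ x. ennreal (g x) \<partial>lborel) = 1"
  shows "\<exists>T. \<forall>x. (T has_real_derivative f x / g (T x)) (at x)"
proof -
  obtain F where F: "\<And>x. (F has_real_derivative f x) (at x)" "inj F" "range F = {0<..<1}"
    using density_distribution_function[OF f] by blast
  obtain G where G: "\<And>x. (G has_real_derivative g x) (at x)" "inj G" "range G = {0<..<1}"
    using density_distribution_function[OF g] by blast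
  have G_inv: "G (inv G (F x)) = F x" for x
    by (rule f_inv_into_f) (simp add: G(3) flip: F(3))
  have "((\<lambda>x. inv G (F x)) has_real_derivative f x / g (inv G (F x))) (at x)" for x
  proof -
    have "(inv G has_derivative (*) (inverse (g (inv G (F x))))) (at (G (inv G (F x))))"
    proof (rule has_derivative_inverse_strong[where f=G and x="inv G (F x)" and S=UNIV])
      show "continuous_on UNIV G"
        using G(1) by (intro continuous_at_imp_continuous_on) (auto intro: DERIV_isCont)
      show "(G has_derivative (*) (g (inv G (F x)))) (at (inv G (F x)))"
        using G(1) by (simp add: has_field_derivative_def)
      show "(*) (g (inv G (F x))) \<circ> (*) (inverse (g (inv G (F x)))) = id"
        using g(2)[of "inv G (F x)"] by (simp add: fun_eq_iff)
    qed (simp_all add: inv_f_f[OF G(2)])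
    then have "(inv G has_real_derivative inverse (g (inv G (F x)))) (at (F x))"
      by (simp add: has_field_derivative_def G_inv)
    from DERIV_chain2[OF this F(1)[of x]] show ?thesis
      by (simp add: field_simps)
  qed
  then show ?thesis
    by blast
qed

text \<open>Shared part of the two substitution rules below. It claims an inequality because
  \<open>R\<close> need not be onto: the left-hand side is the integral of \<open>h\<close> over
  \<open>range R\<close>, so transport maps need no proof of surjectivity.\<close>

lemma nn_integral_image_le:
  fixes h :: "'a::euclidean_space \<Rightarrow> real" and R :: "'a \<Rightarrow> 'a"
  assumes h: "integrable lborel h" "\<And>x. 0 \<le> h x"
    and R: "range R \<in> sets lebesgue" and J: "\<And>x. 0 \<le> J x"
    and subst: "h absolutely_integrable_on range R \<Longrightarrow>
      (\<lambda>x. J x * h (R x)) absolutely_integrable_on UNIV \<and>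
      integral UNIV (\<lambda>x. J x * h (R x)) = integral (range R) h"
  shows "(\<integral>\<^sup>+ x. ennreal (J x * h (R x)) \<partial>lborel) \<le> (\<integral>\<^sup>+ x. ennreal (h x) \<partial>lborel)"
proof -
  have hU: "h absolutely_integrable_on UNIV"
    using h(1) by (simp add: set_integrable_def integrable_completion)
  then have hR: "h absolutely_integrable_on range R"
    using R by (rule set_integrable_subset) auto
  have "((\<lambda>x. J x * h (R x)) has_integral integral (range R) h) UNIV"
    using subst[OF hR] set_lebesgue_integral_eq_integral(1) integrable_integral by fastforce
  then have "(\<integral>\<^sup>+ x. ennreal (J x * h (R x)) \<partial>lborel) = integral (range R) h"
    using nn_integral_has_integral_lebesgue'[of UNIV "\<lambda>x. J x * h (R x)"] J h(2) by simp
  also have "\<dots> \<le> integral UNIV h"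
    using hU hR h(2) by (intro ennreal_leI integral_subset_le) (auto simp: set_lebesgue_integral_eq_integral(1))
  also have "\<dots> = (\<integral>\<^sup>+ x. ennreal (h x) \<partial>lborel)"
    using nn_integral_has_integral_lebesgue'[of UNIV h "integral UNIV h"] h(2)
      set_lebesgue_integral_eq_integral(1)[OF hU]
    by (simp add: integrable_integral)
  finally show ?thesis .
qed

lemma nn_integral_substitution_real_le:
  fixes h R R' :: "real \<Rightarrow> real"
  assumes h: "integrable lborel h" "\<And>x. 0 \<le> h x"
    and R: "\<And>x. (R has_real_derivative R' x) (at x)" "\<And>x. 0 \<le> R' x" "inj R"
  shows "(\<integral>\<^sup>+ x. ennreal (R' x * h (R x)) \<partial>lborel) \<le> (\<integral>\<^sup>+ x. ennreal (h x) \<partial>lborel)"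
proof (rule nn_integral_image_le[OF h])
  show "range R \<in> sets lebesgue"
    by (rule differentiable_image_in_sets_lebesgue)
      (use R(1) real_differentiable_def in \<open>auto simp: differentiable_on_def\<close>)
  show "(\<lambda>x. R' x * h (R x)) absolutely_integrable_on UNIV \<and>
      integral UNIV (\<lambda>x. R' x * h (R x)) = integral (range R) h"
    if "h absolutely_integrable_on range R"
    using has_absolute_integral_change_of_variables_1'[of UNIV R R' h "integral (range R) h"] R that by auto
qed (rule R(2))

lemma nn_integral_substitution_le:
  fixes h :: "real^'m::{finite,wellorder} \<Rightarrow> real" and R :: "real^'m::_ \<Rightarrow> real^'m::_"
  assumes h: "integrable lborel h" "\<And>x. 0 \<le> h x"
    and R: "\<And>x. (R has_derivative R' x) (at x)" "inj R"
  shows "(\<integral>\<^sup>+ x. ennreal (\<bar>det (matrix (R' x))\<bar> * h (R x)) \<partial>lborel) \<le> (\<integral>\<^sup>+ x. ennreal (h x) \<partial>lborel)"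
proof (rule nn_integral_image_le[OF h])
  show "range R \<in> sets lebesgue"
    by (rule differentiable_image_in_sets_lebesgue)
      (use R(1) differentiable_def in \<open>auto simp: differentiable_on_def\<close>)
  show "(\<lambda>x. \<bar>det (matrix (R' x))\<bar> * h (R x)) absolutely_integrable_on UNIV \<and>
      integral UNIV (\<lambda>x. \<bar>det (matrix (R' x))\<bar> * h (R x)) = integral (range R) h"
    if "h absolutely_integrable_on range R"
    using has_absolute_integral_change_of_variables[of UNIV R R' "\<lambda>x. vec (h x) :: real^1" "vec (integral (range R) h)"] R that
    by (simp add: absolutely_integrable_on_1_iff integral_on_1_eq)
qed simp

section \<open>The geometric Brascamp-Lieb inequality\<close>

lemma prod_Basis_vec:
  fixes F :: "real^'m \<Rightarrow> 'b::comm_monoid_mult"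
  shows "(\<Prod>b\<in>Basis. F b) = (\<Prod>j\<in>UNIV. F (axis j 1))"
proof -
  have "inj (\<lambda>j::'m. axis j (1::real))"
    by (auto simp: inj_on_def axis_eq_axis)
  then have "prod F (range (\<lambda>j. axis j 1)) = (\<Prod>j\<in>UNIV. F (axis j 1))"
    by (simp add: prod.reindex)
  moreover have "(Basis :: (real^'m) set) = range (\<lambda>j. axis j 1)"
    by (auto simp: Basis_vec_def)
  ultimately show ?thesis
    by simp
qed

lemma nn_integral_lborel_vec_prod:
  fixes F :: "'m::finite \<Rightarrow> real \<Rightarrow> ennreal"
  assumes "\<And>j. F j \<in> borel_measurable borel"
  shows "(\<integral>\<^sup>+ x. (\<Prod>j\<in>UNIV. F j (x $ j)) \<partial>(lborel :: (real^'m) measure)) = (\<Prod>j\<in>UNIV. \<integral>\<^sup>+ s. F j s \<partial>lborel)"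
proof -
  define K :: "real^'m \<Rightarrow> real \<Rightarrow> ennreal" where "K b = F (THE j. b = axis j 1)" for b
  have K: "K (axis j 1) = F j" for j
    by (simp add: K_def axis_eq_axis)
  have "(\<integral>\<^sup>+ x. (\<Prod>b\<in>Basis. K b (x \<bullet> b)) \<partial>(lborel :: (real^'m) measure)) = (\<Prod>b\<in>Basis. \<integral>\<^sup>+ s. K b s \<partial>lborel)"
    by (rule nn_integral_lborel_prod) (simp_all add: K_def assms)
  then show ?thesis
    by (simp add: prod_Basis_vec K inner_axis)
qed

text \<open>The product form lets integrals factor over the coordinates;
  \<open>gaussian_density_eq\<close> supplies the radial form, from which rotation invariance and
  density ratios are read off.\<close>

definition gaussian_density :: "real^'m \<Rightarrow> real" where
  "gaussian_density x = (\<Prod>j\<in>UNIV. std_normal_density (x $ j))"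

lemma gaussian_density_eq:
  fixes x :: "real^'m"
  shows "gaussian_density x = (1 / sqrt (2 * pi)) ^ CARD('m) * exp (- (x \<bullet> x) / 2)"
  by (simp add: gaussian_density_def std_normal_density_def prod_dividef exp_sum[symmetric]
      sum_negf inner_vec_def power2_eq_square power_divide sum_divide_distrib[symmetric])

lemma gaussian_density_pos: "0 < gaussian_density x"
  by (simp add: gaussian_density_eq)

lemma borel_measurable_gaussian_density [measurable]: "gaussian_density \<in> borel_measurable borel"
  unfolding gaussian_density_eq[abs_def] by measurable

lemma nn_integral_std_normal_density: "(\<integral>\<^sup>+ s. ennreal (std_normal_density s) \<partial>lborel) = 1"
  by (subst nn_integral_eq_integral) (auto simp: normal_density_nonneg)

lemma nn_integral_gaussian_density:
  "(\<integral>\<^sup>+ x. ennreal (gaussian_density x) \<partial>(lborel :: (real^'m) measure)) = 1"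
proof -
  have "(\<integral>\<^sup>+ x. ennreal (gaussian_density x) \<partial>(lborel :: (real^'m) measure)) =
      (\<integral>\<^sup>+ x. (\<Prod>j\<in>UNIV. ennreal (std_normal_density (x $ j))) \<partial>(lborel :: (real^'m) measure))"
    by (simp add: gaussian_density_def prod_ennreal)
  also have "\<dots> = 1"
    using nn_integral_lborel_vec_prod[of "\<lambda>(_::'m) s. ennreal (std_normal_density s)"]
    by (simp add: nn_integral_std_normal_density)
  finally show ?thesis .
qed

lemma integrable_gaussian_density: "integrable lborel gaussian_density"
  by (rule integrableI_nonneg) (simp_all add: nn_integral_gaussian_density gaussian_density_pos less_imp_le)

lemma std_normal_density_ratio: "std_normal_density s / std_normal_density r = exp ((r\<^sup>2 - s\<^sup>2) / 2)"
  by (simp add: std_normal_density_def diff_divide_distrib flip: exp_diff)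

lemma gaussian_density_ratio:
  fixes x y :: "real^'m"
  shows "exp ((x \<bullet> x - y \<bullet> y) / 2) * gaussian_density x = gaussian_density y"
  by (simp add: gaussian_density_eq diff_divide_distrib mult.left_commute flip: exp_add)

text \<open>The synthesis map of a Parseval frame is adjoint to an isometry, hence a contraction.
  Concretely, expand \<open>y \<bullet> y\<close> as the sum of the
  \<open>b i * (y \<bullet> w i)\<close>, bound each product by half the sum of the squares, and
  absorb \<open>y \<bullet> y\<close> on the left.\<close>

lemma frame_synthesis_inner_le:
  fixes w :: "'i \<Rightarrow> 'a::real_inner"
  assumes frame: "\<And>x. (\<Sum>i\<in>I. (x \<bullet> w i)\<^sup>2) = x \<bullet> x"
  shows "(\<Sum>i\<in>I. b i *\<^sub>R w i) \<bullet> (\<Sum>i\<in>I. b i *\<^sub>R w i) \<le> (\<Sum>i\<in>I. (b i)\<^sup>2)"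
proof -
  define y where "y = (\<Sum>i\<in>I. b i *\<^sub>R w i)"
  have "y \<bullet> y = (\<Sum>i\<in>I. b i * (y \<bullet> w i))"
    by (subst (2) y_def) (simp add: inner_sum_right)
  also have "\<dots> \<le> (\<Sum>i\<in>I. ((b i)\<^sup>2 + (y \<bullet> w i)\<^sup>2) / 2)"
  proof (rule sum_mono)
    fix i
    have "0 \<le> (b i - y \<bullet> w i)\<^sup>2"
      by simp
    then show "b i * (y \<bullet> w i) \<le> ((b i)\<^sup>2 + (y \<bullet> w i)\<^sup>2) / 2"
      by (simp add: power2_eq_square algebra_simps)
  qed
  also have "\<dots> = ((\<Sum>i\<in>I. (b i)\<^sup>2) + y \<bullet> y) / 2"
    by (simp add: frame sum.distrib flip: sum_divide_distrib)
  finally show ?thesis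
    by (simp flip: y_def)
qed

text \<open>One-dimensional maps \<open>T i\<close> carry \<open>f i\<close> times the Gaussian,
  divided by \<open>Z i\<close>, to the Gaussian; assembled along the frame they form a map
  \<open>R\<close> of the whole space. Pointwise, the integrand is at most a constant times the
  Jacobian of \<open>R\<close> times the Gaussian density at \<open>R x\<close>, and substitution
  finishes.\<close>

theorem geometric_Brascamp_Lieb:
  fixes w :: "'i \<Rightarrow> real^'m::{finite,wellorder}" and f :: "'i \<Rightarrow> real \<Rightarrow> real" and Z :: "'i \<Rightarrow> real"
  assumes I: "finite I" and w: "\<And>i. i \<in> I \<Longrightarrow> w i \<noteq> 0"
    and frame: "\<And>x. (\<Sum>i\<in>I. (x \<bullet> w i)\<^sup>2) = x \<bullet> x"
    and f: "\<And>i. i \<in> I \<Longrightarrow> continuous_on UNIV (f i)" "\<And>i s. i \<in> I \<Longrightarrow> 0 < f i s"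
    and Z: "\<And>i. i \<in> I \<Longrightarrow> 0 < Z i"
      "\<And>i. i \<in> I \<Longrightarrow> (\<integral>\<^sup>+ s. ennreal (f i s * std_normal_density s) \<partial>lborel) = ennreal (Z i)"
  shows "(\<integral>\<^sup>+ x. ennreal ((\<Prod>i\<in>I. f i (x \<bullet> w i / norm (w i)) powr (norm (w i))\<^sup>2) * gaussian_density x) \<partial>lborel)
    \<le> ennreal (\<Prod>i\<in>I. Z i powr (norm (w i))\<^sup>2)"
proof -
  have cont_g: "continuous_on UNIV std_normal_density"
    unfolding std_normal_density_def by (intro continuous_intros) auto
  have "\<exists>T. \<forall>s. (T has_real_derivative (f i s * std_normal_density s / Z i) / std_normal_density (T s)) (at s)"
    if i: "i \<in> I" for i
  proof -
    have 1: "continuous_on UNIV (\<lambda>s. f i s * std_normal_density s / Z i)"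
      using f(1)[OF i] cont_g Z(1)[OF i] by (intro continuous_intros) auto
    have 2: "0 < f i s * std_normal_density s / Z i" for s
      using f(2)[OF i] Z(1)[OF i] by (simp add: normal_density_pos)
    have 3: "(\<integral>\<^sup>+ s. ennreal (f i s * std_normal_density s / Z i) \<partial>lborel) = 1"
    proof -
      have [measurable]: "f i \<in> borel_measurable borel"
        using f(1)[OF i] by (rule borel_measurable_continuous_onI)
      have "(\<integral>\<^sup>+ s. ennreal (f i s * std_normal_density s / Z i) \<partial>lborel) =
          (\<integral>\<^sup>+ s. ennreal (f i s * std_normal_density s) / ennreal (Z i) \<partial>lborel)"
        using f(2)[OF i] Z(1)[OF i] by (simp add: divide_ennreal less_imp_le)
      also have "\<dots> = ennreal (Z i) / ennreal (Z i)"
        by (subst nn_integral_divide) (simp_all add: Z(2)[OF i])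
      also have "\<dots> = 1"
        using Z(1)[OF i] by (simp add: divide_ennreal)
      finally show ?thesis .
    qed
    show ?thesis
      by (rule monotone_transport[OF 1 2 3 cont_g normal_density_pos nn_integral_std_normal_density]) simp
  qed
  then obtain T where T:
    "\<And>i s. i \<in> I \<Longrightarrow> (T i has_real_derivative (f i s * std_normal_density s / Z i) / std_normal_density (T i s)) (at s)"
    by metis
  define T' where "T' i s = (f i s * std_normal_density s / Z i) / std_normal_density (T i s)" for i s
  have T'_pos: "0 < T' i s" if "i \<in> I" for i s
    using f(2)[OF that] Z(1)[OF that] by (simp add: T'_def normal_density_pos)
  have T_less: "T i s < T i r" if "i \<in> I" "s < r" for i s r
    using \<open>s < r\<close> by (rule DERIV_pos_imp_increasing) (use T T'_pos \<open>i \<in> I\<close> T'_def in metis)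
  \<comment> \<open>The factor \<open>norm (w i)\<close> cancels the one in the argument of
    \<open>T i\<close>, so that the derivative of \<open>R\<close> is the frame operator with
    positive weights \<open>T' i\<close>.\<close>
  define b where "b i x = norm (w i) * T i (x \<bullet> w i / norm (w i))" for i x
  define R where "R x = (\<Sum>i\<in>I. b i x *\<^sub>R w i)" for x
  define R' where "R' x = (\<lambda>h. \<Sum>i\<in>I. (T' i (x \<bullet> w i / norm (w i)) * (h \<bullet> w i)) *\<^sub>R w i)" for x
  have der_R: "(R has_derivative R' x) (at x)" for x
    unfolding R_def R'_def
  proof (intro has_derivative_sum has_derivative_scaleR_left)
    fix i assume i: "i \<in> I"
    have "((\<lambda>x. T i (x \<bullet> w i / norm (w i))) has_derivative
        (\<lambda>h. T' i (x \<bullet> w i / norm (w i)) * (h \<bullet> w i / norm (w i)))) (at x)"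
    proof (rule has_derivative_compose[where f="\<lambda>x. x \<bullet> w i / norm (w i)"
          and f'="\<lambda>h. h \<bullet> w i / norm (w i)" and g'="(*) (T' i (x \<bullet> w i / norm (w i)))"])
      show "((\<lambda>x. x \<bullet> w i / norm (w i)) has_derivative (\<lambda>h. h \<bullet> w i / norm (w i))) (at x)"
        using w[OF i] by (auto intro!: derivative_eq_intros)
      show "(T i has_derivative (*) (T' i (x \<bullet> w i / norm (w i)))) (at (x \<bullet> w i / norm (w i)))"
        using T[OF i] by (simp add: T'_def has_field_derivative_def)
    qed
    then have "(b i has_derivative (\<lambda>h. norm (w i) * (T' i (x \<bullet> w i / norm (w i)) * (h \<bullet> w i / norm (w i))))) (at x)"
      unfolding b_def by (rule has_derivative_mult_right)
    moreover have "(\<lambda>h. norm (w i) * (T' i (x \<bullet> w i / norm (w i)) * (h \<bullet> w i / norm (w i)))) =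
        (\<lambda>h. T' i (x \<bullet> w i / norm (w i)) * (h \<bullet> w i))"
      using w[OF i] by (simp add: fun_eq_iff)
    ultimately show "(b i has_derivative (\<lambda>h. T' i (x \<bullet> w i / norm (w i)) * (h \<bullet> w i))) (at x)"
      by (simp only:)
  qed
  \<comment> \<open>Strict monotonicity: \<open>(R x - R y) \<bullet> (x - y)\<close> is a sum of
    nonnegative terms, each zero only if \<open>x - y\<close> is orthogonal to \<open>w i\<close>;
    the frame identity then forces \<open>x = y\<close>.\<close>
  have "inj R"
  proof (rule injI)
    fix x y assume eq: "R x = R y"
    have mono: "0 \<le> (b i x - b i y) * ((x - y) \<bullet> w i)"
      "(b i x - b i y) * ((x - y) \<bullet> w i) = 0 \<Longrightarrow> (x - y) \<bullet> w i = 0" if i: "i \<in> I" for i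
    proof -
      have n: "0 < norm (w i)"
        using w[OF i] by simp
      consider "x \<bullet> w i = y \<bullet> w i" | "x \<bullet> w i < y \<bullet> w i" "b i x < b i y" | "y \<bullet> w i < x \<bullet> w i" "b i y < b i x"
        using T_less[OF i] n unfolding b_def by (metis divide_strict_right_mono linorder_neqE_linordered_idom mult_strict_left_mono)
      then have "0 \<le> (b i x - b i y) * ((x - y) \<bullet> w i) \<and>
          ((b i x - b i y) * ((x - y) \<bullet> w i) = 0 \<longrightarrow> (x - y) \<bullet> w i = 0)"
        by cases (auto simp: inner_diff_left intro: mult_nonneg_nonneg mult_nonpos_nonpos)
      then show "0 \<le> (b i x - b i y) * ((x - y) \<bullet> w i)"
        "(b i x - b i y) * ((x - y) \<bullet> w i) = 0 \<Longrightarrow> (x - y) \<bullet> w i = 0"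
        by auto
    qed
    have "(\<Sum>i\<in>I. (b i x - b i y) * ((x - y) \<bullet> w i)) = (R x - R y) \<bullet> (x - y)"
      by (simp add: R_def inner_sum_left inner_commute[of "x - y"] flip: sum_subtractf scaleR_diff_left)
    also have "\<dots> = 0"
      using eq by simp
    finally have "(x - y) \<bullet> w i = 0" if "i \<in> I" for i
      using mono that I by (subst (asm) sum_nonneg_eq_0_iff) auto
    then have "(x - y) \<bullet> (x - y) = 0"
      unfolding frame[symmetric] by simp
    then show "x = y"
      by simp
  qed
  let ?C = "\<Prod>i\<in>I. Z i powr (norm (w i))\<^sup>2"
  have bound: "(\<Prod>i\<in>I. f i (x \<bullet> w i / norm (w i)) powr (norm (w i))\<^sup>2) * gaussian_density x
      \<le> ?C * (\<bar>det (matrix (R' x))\<bar> * gaussian_density (R x))" for x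
  proof -
    define s where "s i = x \<bullet> w i / norm (w i)" for i
    \<comment> \<open>Solve the transport equation for \<open>f i\<close>; the quotient of Gaussian
      densities is an exponential, and the power \<open>(norm (w i))\<^sup>2\<close> undoes the
      normalization of the argument \<open>s i\<close>.\<close>
    have f_eq: "f i (s i) powr (norm (w i))\<^sup>2 = Z i powr (norm (w i))\<^sup>2 * (T' i (s i) powr (norm (w i))\<^sup>2 *
        exp (((x \<bullet> w i)\<^sup>2 - (b i x)\<^sup>2) / 2))" if i: "i \<in> I" for i
    proof -
      have "std_normal_density (T i (s i)) / std_normal_density (s i) = exp (((s i)\<^sup>2 - (T i (s i))\<^sup>2) / 2)"
        by (rule std_normal_density_ratio)
      moreover have "f i (s i) = Z i * (T' i (s i) * (std_normal_density (T i (s i)) / std_normal_density (s i)))"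
        using Z(1)[OF i] normal_density_pos[of 1 0 "s i"] normal_density_pos[of 1 0 "T i (s i)"]
        by (simp add: T'_def)
      ultimately have "f i (s i) = Z i * (T' i (s i) * exp (((s i)\<^sup>2 - (T i (s i))\<^sup>2) / 2))"
        by simp
      moreover have "exp (((s i)\<^sup>2 - (T i (s i))\<^sup>2) / 2) powr (norm (w i))\<^sup>2 = exp (((x \<bullet> w i)\<^sup>2 - (b i x)\<^sup>2) / 2)"
        using w[OF i] by (simp add: powr_def s_def b_def power_mult_distrib power_divide algebra_simps)
      ultimately show ?thesis
        using Z(1)[OF i] T'_pos[OF i, of "s i"] by (simp add: powr_mult)
    qed
    have "(\<Prod>i\<in>I. f i (s i) powr (norm (w i))\<^sup>2) * gaussian_density x =
        ?C * ((\<Prod>i\<in>I. T' i (s i) powr (norm (w i))\<^sup>2) *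
          (exp (\<Sum>i\<in>I. ((x \<bullet> w i)\<^sup>2 - (b i x)\<^sup>2) / 2) * gaussian_density x))"
      using I by (simp add: f_eq prod.distrib exp_sum)
    also have "\<dots> \<le> ?C * (\<bar>det (matrix (R' x))\<bar> * gaussian_density (R x))"
    proof (intro mult_left_mono mult_mono)
      show "(\<Prod>i\<in>I. T' i (s i) powr (norm (w i))\<^sup>2) \<le> \<bar>det (matrix (R' x))\<bar>"
        using det_frame_operator_ge[OF I frame, of "\<lambda>i. T' i (s i)"] T'_pos
        by (simp add: R'_def s_def)
      \<comment> \<open>The frame identity evaluates the part of the exponent in \<open>x\<close>,
        and the contraction property controls the part in \<open>R x\<close>.\<close>
      have "(\<Sum>i\<in>I. ((x \<bullet> w i)\<^sup>2 - (b i x)\<^sup>2) / 2) = (x \<bullet> x - (\<Sum>i\<in>I. (b i x)\<^sup>2)) / 2"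
        by (simp add: sum_subtractf frame flip: sum_divide_distrib)
      also have "\<dots> \<le> (x \<bullet> x - R x \<bullet> R x) / 2"
        unfolding R_def using frame_synthesis_inner_le[OF frame, of "\<lambda>i. b i x"] by simp
      finally have "exp (\<Sum>i\<in>I. ((x \<bullet> w i)\<^sup>2 - (b i x)\<^sup>2) / 2) * gaussian_density x
          \<le> exp ((x \<bullet> x - R x \<bullet> R x) / 2) * gaussian_density x"
        using gaussian_density_pos[of x] by (intro mult_right_mono) auto
      also have "\<dots> = gaussian_density (R x)"
        by (rule gaussian_density_ratio)
      finally show "exp (\<Sum>i\<in>I. ((x \<bullet> w i)\<^sup>2 - (b i x)\<^sup>2) / 2) * gaussian_density x \<le> gaussian_density (R x)" .
    qed (auto intro!: prod_nonneg mult_nonneg_nonneg simp: gaussian_density_pos less_imp_le)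
    finally show ?thesis
      by (simp add: s_def)
  qed
  have "(\<integral>\<^sup>+ x. ennreal ((\<Prod>i\<in>I. f i (x \<bullet> w i / norm (w i)) powr (norm (w i))\<^sup>2) * gaussian_density x) \<partial>lborel)
      \<le> (\<integral>\<^sup>+ x. ennreal (\<bar>det (matrix (R' x))\<bar> * (?C * gaussian_density (R x))) \<partial>lborel)"
    using bound by (intro nn_integral_mono ennreal_leI) (simp add: mult.left_commute)
  also have "\<dots> \<le> (\<integral>\<^sup>+ x. ennreal (?C * gaussian_density x) \<partial>(lborel :: (real^'m::_) measure))"
    using der_R \<open>inj R\<close>
    by (intro nn_integral_substitution_le[where h="\<lambda>x. ?C * gaussian_density x"] integrable_mult_right integrable_gaussian_density)
      (simp_all add: gaussian_density_pos less_imp_le prod_nonneg)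
  also have "\<dots> = ennreal ?C"
    by (simp add: ennreal_mult' prod_nonneg nn_integral_cmult nn_integral_gaussian_density)
  finally show ?thesis .
qed

section \<open>The one-dimensional Prekopa argument\<close>

lemma mult_ln_le:
  fixes t x :: real
  assumes "0 < t" "0 < x"
  shows "x * (1 + ln t - ln x) \<le> t"
proof -
  have "ln (t / x) \<le> t / x - 1"
    using assms by (intro ln_le_minus_one) simp
  then show ?thesis
    using assms by (simp add: ln_div field_simps)
qed

text \<open>The tangent plane at \<open>(1, 1)\<close> of the convex function
  \<open>x powr p / s powr q\<close>, where \<open>q = (p - 2) / 2\<close> and
  \<open>s = 1 / r\<close>; the constant \<open>p / 2\<close> is \<open>p - q - 1\<close>.\<close>

lemma powr_perspective_tangent:
  fixes p x r :: real
  assumes p: "2 \<le> p" and x: "0 \<le> x" and r: "0 < r"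
  shows "p * x \<le> r powr ((p - 2) / 2) * x powr p + (p - 2) / 2 / r + p / 2"
proof (cases "x = 0")
  case True
  have "0 \<le> (p - 2) / 2 / r"
    using p r by simp
  with True p show ?thesis
    by simp
next
  case False
  with x have x: "0 < x"
    by simp
  define q where "q = (p - 2) / 2"
  have q: "0 \<le> q" "p = 2 * q + 2"
    using p by (simp_all add: q_def field_simps)
  \<comment> \<open>\<open>mult_ln_le\<close> is used with \<open>t\<close> equal to
    \<open>r powr q * x powr p\<close>, \<open>1 / r\<close> and \<open>1\<close>, with weights
    \<open>1\<close>, \<open>q\<close> and \<open>p / 2\<close>. The weights add up to
    \<open>p\<close>, and all logarithms cancel.\<close>
  have "x * (1 + (q * ln r + p * ln x) - ln x) \<le> r powr q * x powr p"
    using mult_ln_le[of "r powr q * x powr p" x] x r by (simp add: ln_mult ln_powr)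
  moreover have "q * (x * (1 - ln r - ln x)) \<le> q * (1 / r)"
    using mult_ln_le[of "1 / r" x] x r q by (intro mult_left_mono) (simp_all add: ln_div)
  moreover have "(p / 2) * (x * (1 + ln 1 - ln x)) \<le> (p / 2) * 1"
    using x p by (intro mult_left_mono mult_ln_le) auto
  ultimately have "x * (1 + (q * ln r + p * ln x) - ln x) + q * (x * (1 - ln r - ln x)) + (p / 2) * (x * (1 - ln x))
      \<le> r powr q * x powr p + q / r + p / 2"
    by simp
  moreover have "x * (1 + (q * ln r + p * ln x) - ln x) + q * (x * (1 - ln r - ln x)) + (p / 2) * (x * (1 - ln x)) = p * x"
    unfolding q(2) by (simp add: field_simps)
  ultimately show ?thesis
    by (simp add: q_def)
qed

text \<open>Jensen's inequality for \<open>\<bar>y\<bar> powr p / s powr q\<close>, where the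
  \<open>s i = 1 / r i\<close> have mean at most one. Dividing by the modulus \<open>u\<close> of
  the mean of the \<open>y i\<close> reduces it to the tangent plane at \<open>(1, 1)\<close>, whose
  inequality is averaged.\<close>

lemma powr_weighted_sum_le:
  fixes a r y :: "'i \<Rightarrow> real"
  assumes p: "2 \<le> p" and a: "\<And>i. i \<in> I \<Longrightarrow> 0 \<le> a i" "sum a I = 1"
    and r: "\<And>i. i \<in> I \<Longrightarrow> 0 < r i" "(\<Sum>i\<in>I. a i / r i) \<le> 1"
  shows "\<bar>\<Sum>i\<in>I. a i * y i\<bar> powr p \<le> (\<Sum>i\<in>I. a i * (r i powr ((p - 2) / 2) * \<bar>y i\<bar> powr p))"
proof (cases "(\<Sum>i\<in>I. a i * y i) = 0")
  case True
  then show ?thesis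
    using a by (auto intro!: sum_nonneg mult_nonneg_nonneg)
next
  case False
  define u where "u = \<bar>\<Sum>i\<in>I. a i * y i\<bar>"
  have u: "0 < u"
    using False by (simp add: u_def)
  have "u \<le> (\<Sum>i\<in>I. \<bar>a i * y i\<bar>)"
    unfolding u_def by (rule sum_abs)
  also have "\<dots> = (\<Sum>i\<in>I. a i * \<bar>y i\<bar>)"
    using a by (intro sum.cong) (auto simp: abs_mult)
  also have "\<dots> = u * (\<Sum>i\<in>I. a i * (\<bar>y i\<bar> / u))"
    using u by (simp add: sum_distrib_left)
  finally have "1 \<le> (\<Sum>i\<in>I. a i * (\<bar>y i\<bar> / u))"
    using u by simp
  then have "p \<le> p * (\<Sum>i\<in>I. a i * (\<bar>y i\<bar> / u))"
    using p by simp
  also have "\<dots> = (\<Sum>i\<in>I. a i * (p * (\<bar>y i\<bar> / u)))"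
    by (simp add: sum_distrib_left mult.left_commute)
  also have "\<dots> \<le> (\<Sum>i\<in>I. a i * (r i powr ((p - 2) / 2) * (\<bar>y i\<bar> / u) powr p + (p - 2) / 2 / r i + p / 2))"
    using a r p u by (intro sum_mono mult_left_mono powr_perspective_tangent) auto
  also have "\<dots> = (\<Sum>i\<in>I. a i * (r i powr ((p - 2) / 2) * (\<bar>y i\<bar> / u) powr p))
      + (p - 2) / 2 * (\<Sum>i\<in>I. a i / r i) + p / 2 * sum a I"
    unfolding sum_distrib_left sum.distrib[symmetric]
    by (intro sum.cong) (simp_all add: distrib_left mult.commute)
  also have "\<dots> \<le> (\<Sum>i\<in>I. a i * (r i powr ((p - 2) / 2) * (\<bar>y i\<bar> / u) powr p)) + (p - 2) / 2 * 1 + p / 2 * 1"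
    using p r(2) a(2) by (intro add_mono mult_left_mono) auto
  finally have "1 \<le> (\<Sum>i\<in>I. a i * (r i powr ((p - 2) / 2) * (\<bar>y i\<bar> / u) powr p))"
    by (simp add: field_simps)
  also have "\<dots> = (\<Sum>i\<in>I. a i * (r i powr ((p - 2) / 2) * \<bar>y i\<bar> powr p)) / u powr p"
    using u by (simp add: powr_divide sum_divide_distrib)
  finally show ?thesis
    using u by (simp add: u_def)
qed

text \<open>The function written \<open>\<phi>\<close> in the overview, with the dependence on
  \<open>p\<close> made explicit.\<close>

definition normal_laplace :: "real \<Rightarrow> real \<Rightarrow> real" where
  "normal_laplace p t = (\<integral>s. exp (- t * \<bar>s\<bar> powr p) * std_normal_density s \<partial>lborel)"

lemma continuous_exp_powr:
  assumes "0 < p"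
  shows "continuous_on UNIV (\<lambda>s::real. exp (- t * \<bar>s\<bar> powr p))"
  using assms by (intro continuous_intros continuous_on_powr') auto

lemma integrable_normal_laplace:
  assumes "0 \<le> t"
  shows "integrable lborel (\<lambda>s. exp (- t * \<bar>s\<bar> powr p) * std_normal_density s)"
  by (rule Bochner_Integration.integrable_bound[OF integrable_normal_density[of 1 0]])
    (use assms in \<open>auto simp: mult_left_le_one_le\<close>)

lemma nn_integral_normal_laplace:
  assumes "0 \<le> t"
  shows "(\<integral>\<^sup>+ s. ennreal (exp (- t * \<bar>s\<bar> powr p) * std_normal_density s) \<partial>lborel) = ennreal (normal_laplace p t)"
  unfolding normal_laplace_def by (rule nn_integral_eq_integral[OF integrable_normal_laplace[OF assms]]) simp

lemma normal_laplace_pos: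
  assumes "0 \<le> t"
  shows "0 < normal_laplace p t"
proof -
  have "normal_laplace p t \<noteq> 0"
  proof
    assume "normal_laplace p t = 0"
    then have "AE s in lborel. exp (- t * \<bar>s\<bar> powr p) * std_normal_density s = 0"
      unfolding normal_laplace_def
      by (subst (asm) integral_nonneg_eq_0_iff_AE[OF integrable_normal_laplace[OF assms]]) auto
    then have "AE s in (lborel :: real measure). False"
      by (rule eventually_mono) (simp add: std_normal_density_def)
    then show False
      by (simp add: AE_iff_null null_sets_def)
  qed
  moreover have "0 \<le> normal_laplace p t"
    unfolding normal_laplace_def by (intro integral_nonneg_AE) auto
  ultimately show ?thesis
    by simp
qed

text \<open>With weights \<open>a i = c i / k\<close> this is a Prekopa-Leindler inequality for
  several functions, raised to the power \<open>k\<close>. Here the transport runs from the Gaussian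
  to the normalized densities, and the average \<open>R\<close> of the maps \<open>S i\<close> is
  substituted into the integral on the right.\<close>

lemma normal_laplace_prod_le:
  fixes c :: "'i \<Rightarrow> real" and k n :: real
  assumes p: "2 \<le> p" and t: "0 \<le> t" and I: "finite I" "real (card I) \<le> n"
    and c: "\<And>i. i \<in> I \<Longrightarrow> 0 < c i" "sum c I = k" and k: "0 < k"
  shows "(\<Prod>i\<in>I. normal_laplace p (t * c i powr ((p - 2) / 2)) powr c i)
    \<le> normal_laplace p (t * (k / n) powr ((p - 2) / 2)) powr k"
proof -
  let ?q = "(p - 2) / 2"
  let ?g = std_normal_density
  have "I \<noteq> {}"
    using c(2) k by auto
  then have n: "0 < n"
    using I by (metis card_gt_0_iff less_le_trans of_nat_0_less_iff)
  define \<mu> where "\<mu> i = t * c i powr ?q" for i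
  define \<nu> where "\<nu> = t * (k / n) powr ?q"
  define Z where "Z i = normal_laplace p (\<mu> i)" for i
  define a where "a i = c i / k" for i
  have \<mu>: "0 \<le> \<mu> i" for i
    using t by (simp add: \<mu>_def)
  have \<nu>: "0 \<le> \<nu>"
    using t by (simp add: \<nu>_def)
  have Z: "0 < Z i" for i
    unfolding Z_def by (rule normal_laplace_pos[OF \<mu>])
  have a: "\<And>i. i \<in> I \<Longrightarrow> 0 < a i" "sum a I = 1"
    using c k by (simp_all add: a_def flip: sum_divide_distrib)
  have cont_g: "continuous_on UNIV ?g"
    unfolding std_normal_density_def by (intro continuous_intros) auto
  have "\<exists>S. \<forall>s. (S has_real_derivative ?g s / (exp (- \<mu> i * \<bar>S s\<bar> powr p) * ?g (S s) / Z i)) (at s)" for i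
  proof -
    have 1: "continuous_on UNIV (\<lambda>s. exp (- \<mu> i * \<bar>s\<bar> powr p) * ?g s / Z i)"
      using cont_g Z[of i] p by (intro continuous_on_divide continuous_on_mult continuous_exp_powr continuous_intros) auto
    have 2: "0 < exp (- \<mu> i * \<bar>s\<bar> powr p) * ?g s / Z i" for s
      using Z[of i] by (simp add: normal_density_pos)
    have 3: "(\<integral>\<^sup>+ s. ennreal (exp (- \<mu> i * \<bar>s\<bar> powr p) * ?g s / Z i) \<partial>lborel) = 1"
    proof -
      have "(\<integral>\<^sup>+ s. ennreal (exp (- \<mu> i * \<bar>s\<bar> powr p) * ?g s / Z i) \<partial>lborel) =
          (\<integral>\<^sup>+ s. ennreal (exp (- \<mu> i * \<bar>s\<bar> powr p) * ?g s) / ennreal (Z i) \<partial>lborel)"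
        using Z[of i] by (simp add: divide_ennreal)
      also have "\<dots> = ennreal (Z i) / ennreal (Z i)"
        by (subst nn_integral_divide) (simp_all add: nn_integral_normal_laplace[OF \<mu>, simplified] Z_def)
      also have "\<dots> = 1"
        using Z[of i] by (simp add: divide_ennreal)
      finally show ?thesis .
    qed
    show ?thesis
      by (rule monotone_transport[OF cont_g normal_density_pos nn_integral_std_normal_density 1 2 3]) simp
  qed
  then obtain S where S:
    "\<And>i s. (S i has_real_derivative ?g s / (exp (- \<mu> i * \<bar>S i s\<bar> powr p) * ?g (S i s) / Z i)) (at s)"
    by metis
  define S' where "S' i s = ?g s / (exp (- \<mu> i * \<bar>S i s\<bar> powr p) * ?g (S i s) / Z i)" for i s
  have S'_pos: "0 < S' i s" for i s
    using Z[of i] by (simp add: S'_def normal_density_pos)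
  define R where "R s = (\<Sum>i\<in>I. a i * S i s)" for s
  define R' where "R' s = (\<Sum>i\<in>I. a i * S' i s)" for s
  have der_R: "(R has_real_derivative R' s) (at s)" for s
    unfolding R_def R'_def using S by (intro DERIV_sum DERIV_cmult) (simp add: S'_def)
  have R'_pos: "0 < R' s" for s
    unfolding R'_def using I \<open>I \<noteq> {}\<close> a S'_pos by (intro sum_pos) auto
  have R_less: "R s < R r" if "s < r" for s r
    by (rule DERIV_pos_imp_increasing[OF that]) (use der_R R'_pos in blast)
  have "inj R"
    by (rule linorder_injI) (metis R_less less_irrefl)
  let ?C = "\<Prod>i\<in>I. Z i powr a i"
  let ?h = "\<lambda>s. exp (- \<nu> * \<bar>s\<bar> powr p) * ?g s"
  \<comment> \<open>The arithmetic-geometric mean inequality bounds the Jacobian \<open>R'\<close>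
    from below by the product of the \<open>S' i s powr a i\<close>; convexity bounds the exponent
    at \<open>R s\<close> by the average of the exponents at \<open>S i s\<close>.\<close>
  have bound: "?C * ?g s \<le> R' s * ?h (R s)" for s
  proof -
    have "S' i s = Z i * exp (\<mu> i * \<bar>S i s\<bar> powr p + ((S i s)\<^sup>2 - s\<^sup>2) / 2)" for i
    proof -
      have "S' i s = Z i * exp (\<mu> i * \<bar>S i s\<bar> powr p) * (?g s / ?g (S i s))"
        by (simp add: S'_def exp_minus field_simps)
      then show ?thesis
        by (simp add: std_normal_density_ratio exp_add)
    qed
    then have "S' i s powr a i = Z i powr a i * exp (a i * (\<mu> i * \<bar>S i s\<bar> powr p + ((S i s)\<^sup>2 - s\<^sup>2) / 2))" for i
      using Z[of i] by (simp add: powr_mult exp_powr_real mult.commute)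
    then have "?C * exp (\<Sum>i\<in>I. a i * (\<mu> i * \<bar>S i s\<bar> powr p + ((S i s)\<^sup>2 - s\<^sup>2) / 2)) = (\<Prod>i\<in>I. S' i s powr a i)"
      using I by (simp add: prod.distrib exp_sum)
    also have "\<dots> \<le> R' s"
      unfolding R'_def using I a S'_pos by (intro weighted_arith_geom_mean) (auto simp: less_imp_le)
    finally have ge: "?C * exp (\<Sum>i\<in>I. a i * (\<mu> i * \<bar>S i s\<bar> powr p + ((S i s)\<^sup>2 - s\<^sup>2) / 2)) \<le> R' s" .
    have le: "\<nu> * \<bar>R s\<bar> powr p + ((R s)\<^sup>2 - s\<^sup>2) / 2
        \<le> (\<Sum>i\<in>I. a i * (\<mu> i * \<bar>S i s\<bar> powr p + ((S i s)\<^sup>2 - s\<^sup>2) / 2))"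
    proof -
      \<comment> \<open>\<open>\<nu> * (c i * n / k) powr ?q\<close> is \<open>\<mu> i\<close>. The
        weighted reciprocals \<open>a i / (c i * n / k)\<close> are all \<open>1 / n\<close> and sum
        to at most one; this fixes the ratio \<open>k / n\<close> in the claim.\<close>
      have "\<bar>R s\<bar> powr p \<le> (\<Sum>i\<in>I. a i * ((c i * n / k) powr ?q * \<bar>S i s\<bar> powr p))"
        unfolding R_def
      proof (rule powr_weighted_sum_le[OF p])
        have "(\<Sum>i\<in>I. a i / (c i * n / k)) = (\<Sum>i\<in>I. 1 / n)"
        proof (rule sum.cong)
          fix i assume "i \<in> I"
          then show "a i / (c i * n / k) = 1 / n"
            using c(1)[of i] k n by (simp add: a_def field_simps)
        qed simp
        then show "(\<Sum>i\<in>I. a i / (c i * n / k)) \<le> 1"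
          using I n by simp
      qed (use a c k n in \<open>auto simp: less_imp_le\<close>)
      then have "\<nu> * \<bar>R s\<bar> powr p \<le> \<nu> * (\<Sum>i\<in>I. a i * ((c i * n / k) powr ?q * \<bar>S i s\<bar> powr p))"
        using \<nu> by (rule mult_left_mono)
      also have "\<dots> = (\<Sum>i\<in>I. a i * (\<mu> i * \<bar>S i s\<bar> powr p))"
      proof -
        have "\<nu> * (c i * n / k) powr ?q = \<mu> i" if "i \<in> I" for i
          using c(1)[OF that] k n by (simp add: \<nu>_def \<mu>_def powr_divide powr_mult)
        then show ?thesis
          unfolding sum_distrib_left by (intro sum.cong) (simp_all add: mult.left_commute mult.assoc[symmetric])
      qed
      finally have 1: "\<nu> * \<bar>R s\<bar> powr p \<le> (\<Sum>i\<in>I. a i * (\<mu> i * \<bar>S i s\<bar> powr p))" .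
      \<comment> \<open>The Gaussian part of the exponent only needs convexity of the
        square.\<close>
      have "(R s)\<^sup>2 \<le> (\<Sum>i\<in>I. a i * (S i s)\<^sup>2)"
        using convex_on_sum[OF I(1) \<open>I \<noteq> {}\<close> convex_power2 a(2), of "\<lambda>i. S i s"] a(1)
        by (simp add: R_def less_imp_le)
      moreover have "(\<Sum>i\<in>I. a i * (((S i s)\<^sup>2 - s\<^sup>2) / 2)) = ((\<Sum>i\<in>I. a i * (S i s)\<^sup>2) - s\<^sup>2) / 2"
        using a(2) by (simp add: right_diff_distrib sum_subtractf flip: sum_divide_distrib sum_distrib_right)
      ultimately have 2: "((R s)\<^sup>2 - s\<^sup>2) / 2 \<le> (\<Sum>i\<in>I. a i * (((S i s)\<^sup>2 - s\<^sup>2) / 2))"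
        by (simp only:) (simp add: divide_right_mono)
      show ?thesis
        unfolding distrib_left sum.distrib by (rule add_mono[OF 1 2])
    qed
    have "?C * exp (\<nu> * \<bar>R s\<bar> powr p + ((R s)\<^sup>2 - s\<^sup>2) / 2)
        \<le> ?C * exp (\<Sum>i\<in>I. a i * (\<mu> i * \<bar>S i s\<bar> powr p + ((S i s)\<^sup>2 - s\<^sup>2) / 2))"
      using le by (intro mult_left_mono prod_nonneg) auto
    then have "?C * exp (\<nu> * \<bar>R s\<bar> powr p + ((R s)\<^sup>2 - s\<^sup>2) / 2) \<le> R' s"
      using ge by (rule order_trans)
    then have "?C * exp (\<nu> * \<bar>R s\<bar> powr p + ((R s)\<^sup>2 - s\<^sup>2) / 2) * ?h (R s) \<le> R' s * ?h (R s)"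
      by (rule mult_right_mono) simp
    moreover have "exp (\<nu> * \<bar>R s\<bar> powr p + ((R s)\<^sup>2 - s\<^sup>2) / 2) * ?h (R s) = ?g s"
      by (simp add: std_normal_density_def diff_divide_distrib flip: exp_add)
    ultimately show ?thesis
      by (simp only: mult.assoc)
  qed
  have "ennreal ?C = (\<integral>\<^sup>+ s. ennreal (?C * ?g s) \<partial>lborel)"
    by (simp add: ennreal_mult' prod_nonneg nn_integral_cmult nn_integral_std_normal_density)
  also have "\<dots> \<le> (\<integral>\<^sup>+ s. ennreal (R' s * ?h (R s)) \<partial>lborel)"
    using bound by (intro nn_integral_mono ennreal_leI)
  also have "\<dots> \<le> (\<integral>\<^sup>+ s. ennreal (?h s) \<partial>lborel)"
    using der_R R'_pos \<open>inj R\<close> integrable_normal_laplace[OF \<nu>]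
    by (intro nn_integral_substitution_real_le) (auto simp: less_imp_le)
  also have "\<dots> = ennreal (normal_laplace p \<nu>)"
    by (rule nn_integral_normal_laplace[OF \<nu>])
  finally have "?C \<le> normal_laplace p \<nu>"
    using normal_laplace_pos[OF \<nu>, of p] by (simp add: ennreal_le_iff)
  then have "?C powr k \<le> normal_laplace p \<nu> powr k"
    using k by (intro powr_mono2) (auto intro: prod_nonneg)
  moreover have "?C powr k = (\<Prod>i\<in>I. Z i powr c i)"
    using k by (simp add: prod_powr_distrib powr_powr a_def)
  ultimately show ?thesis
    by (simp add: Z_def \<mu>_def \<nu>_def)
qed

section \<open>Gaussian vectors\<close>

text \<open>
  The change of variables theorem of the library needs a well-ordered index type.  This type is a
  well-ordered copy of an arbitrary finite type.
\<close>

typedef ('a::finite) ordcopy = "{..<CARD('a)}"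
  by (rule exI[of _ 0]) simp

instantiation ordcopy :: (finite) "{finite, wellorder}"
begin

definition less_eq_ordcopy :: "'a ordcopy \<Rightarrow> 'a ordcopy \<Rightarrow> bool"
  where "x \<le> y \<longleftrightarrow> Rep_ordcopy x \<le> Rep_ordcopy y"

definition less_ordcopy :: "'a ordcopy \<Rightarrow> 'a ordcopy \<Rightarrow> bool"
  where "x < y \<longleftrightarrow> Rep_ordcopy x < Rep_ordcopy y"

instance
proof
  show "finite (UNIV :: 'a ordcopy set)"
    using type_definition.univ[OF type_definition_ordcopy] by (metis finite_imageI finite_lessThan)
next
  fix P and a :: "'a ordcopy"
  assume step: "\<And>x :: 'a ordcopy. (\<And>y. y < x \<Longrightarrow> P y) \<Longrightarrow> P x"
  show "P a"
    by (induction "Rep_ordcopy a" arbitrary: a rule: less_induct)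
      (use step in \<open>auto simp: less_ordcopy_def\<close>)
qed (auto simp: less_eq_ordcopy_def less_ordcopy_def Rep_ordcopy_inject)

end

lemma CARD_ordcopy: "CARD('a::finite ordcopy) = CARD('a)"
  using type_definition.card[OF type_definition_ordcopy] by simp

section \<open>The law of a Gaussian vector in orthonormal coordinates\<close>

lemma borel_measurable_vec_nth [measurable]: "(\<lambda>x :: real^'n. x $ i) \<in> borel_measurable borel"
  by (simp add: borel_measurable_continuous_onI continuous_on_component)

text \<open>Indexing by a finite type makes coordinate vectors elements of \<open>real^'m\<close>,
  where Lebesgue measure is available.\<close>

definition orthonormal_family :: "('m::finite \<Rightarrow> 'a::euclidean_space) \<Rightarrow> bool" where
  "orthonormal_family v \<longleftrightarrow> (\<forall>i j. v i \<bullet> v j = (if i = j then 1 else 0))"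

lemma orthonormal_family_inner_sum:
  fixes v :: "'m::finite \<Rightarrow> 'a::euclidean_space" and x :: "real^'m"
  assumes "orthonormal_family v"
  shows "(\<Sum>j\<in>UNIV. x $ j *\<^sub>R v j) \<bullet> (\<Sum>j\<in>UNIV. x $ j *\<^sub>R v j) = x \<bullet> x"
proof -
  have o: "v i \<bullet> v j = (if i = j then 1 else 0)" for i j
    using assms by (simp add: orthonormal_family_def)
  show ?thesis
    by (simp add: o inner_sum_left inner_sum_right inner_vec_def if_distrib cong: if_cong)
qed

text \<open>The abstract law becomes an integral against a density. The index type may be any one of
  cardinality \<open>dim E\<close>, in particular a well-ordered copy. The coordinates of
  \<open>G\<close> and those of a vector with density \<open>gaussian_density\<close> both have the
  product of standard normal laws as joint law.\<close>

lemma std_gaussian_on_nn_integral: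
  fixes E :: "'a::euclidean_space set"
  assumes G: "std_gaussian_on M E G" and dim: "dim E = CARD('m::finite)"
  shows "\<exists>v :: 'm \<Rightarrow> 'a. orthonormal_family v \<and> 
    (\<forall>F \<in> borel_measurable borel. (\<integral>\<^sup>+ \<omega>. F (G \<omega>) \<partial>M) =
      (\<integral>\<^sup>+ x. F (\<Sum>j\<in>UNIV. x $ j *\<^sub>R v j) * ennreal (gaussian_density x) \<partial>(lborel :: (real^'m) measure)))"
proof -
  interpret prob_space M
    using G by (simp add: std_gaussian_on_def)
  have G_meas [measurable]: "G \<in> borel_measurable M" and G_E: "AE \<omega> in M. G \<omega> \<in> E"
    using G by (auto simp: std_gaussian_on_def)
  obtain B where B: "orthonormal_basis_of E B"
    and indep: "indep_vars (\<lambda>_. borel) (\<lambda>b \<omega>. G \<omega> \<bullet> b) B"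
    and normal: "\<And>b. b \<in> B \<Longrightarrow> distributed M lborel (\<lambda>\<omega>. G \<omega> \<bullet> b) std_normal_density"
    using G by (auto simp: std_gaussian_on_def)
  then have ortho: "pairwise orthogonal B" and unit: "\<And>b. b \<in> B \<Longrightarrow> norm b = 1" and span: "span B = E"
    by (auto simp: orthonormal_basis_of_def)
  have ind: "independent B"
    using ortho unit[of 0] by (intro pairwise_orthogonal_independent) auto
  then have fin [simp]: "finite B"
    by (rule independent_imp_finite)
  have "card B = CARD('m)"
    using dim_eq_card[of B E] ind span dim by (metis span_span)
  then obtain v :: "'m \<Rightarrow> 'a" where v: "bij_betw v UNIV B"
    using finite_same_card_bij[of "UNIV :: 'm set" B] by auto
  have "B \<noteq> {}"
    using v by (auto simp: bij_betw_def)
  define u where "u = inv_into UNIV v"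
  have vu: "v (u b) = b" if "b \<in> B" for b
    using v that by (auto simp: u_def bij_betw_def f_inv_into_f)
  have uv: "u (v j) = j" for j
    using v by (auto simp: u_def bij_betw_def)
  have vB: "v j \<in> B" for j
    using v by (auto simp: bij_betw_def)
  have "orthonormal_family v"
    unfolding orthonormal_family_def
  proof (intro allI)
    fix i j
    have "v i = v j \<longleftrightarrow> i = j"
      using uv by metis
    then show "v i \<bullet> v j = (if i = j then 1 else 0)"
      using ortho unit vB[of i] vB[of j] by (auto simp: pairwise_def orthogonal_def norm_eq_1)
  qed
  let ?N = "density lborel (\<lambda>s. ennreal (std_normal_density s))"
  interpret N: product_prob_space "\<lambda>_::'a. ?N" B
    using prob_space_normal_density[of 1 0] by (intro product_prob_spaceI) auto
  define P where "P = distr (density (lborel :: (real^'m) measure) (\<lambda>x. ennreal (gaussian_density x)))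
    (\<Pi>\<^sub>M b\<in>B. borel) (\<lambda>x. \<lambda>b\<in>B. x $ u b)"
  have coords [measurable]: "(\<lambda>x :: real^'m. \<lambda>b\<in>B. x $ u b) \<in> borel \<rightarrow>\<^sub>M (\<Pi>\<^sub>M b\<in>B. borel)"
    by measurable
  \<comment> \<open>A product measure is determined by its values on boxes, where the integral of
    the Gaussian density factors.\<close>
  have "P = (\<Pi>\<^sub>M b\<in>B. ?N)"
  proof (rule N.PiM_eqI)
    show "sets P = sets (\<Pi>\<^sub>M b\<in>B. ?N)"
      unfolding P_def by (simp cong: sets_PiM_cong)
    fix A :: "'a \<Rightarrow> real set" assume "\<And>b. b \<in> B \<Longrightarrow> A b \<in> sets ?N"
    then have A: "A (v j) \<in> sets borel" for j
      using vB by simp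
    have A': "Pi\<^sub>E B A \<in> sets (\<Pi>\<^sub>M b\<in>B. borel)"
      using A vu by (intro sets_PiM_I_finite) (auto, metis)
    let ?Q = "(\<lambda>x :: real^'m. \<lambda>b\<in>B. x $ u b) -` Pi\<^sub>E B A"
    have Q: "?Q \<in> sets borel"
      using measurable_sets[OF coords A'] by simp
    have "emeasure P (Pi\<^sub>E B A) = emeasure (density lborel (\<lambda>x. ennreal (gaussian_density x))) ?Q"
      unfolding P_def using A' by (subst emeasure_distr) simp_all
    also have "\<dots> = (\<integral>\<^sup>+ x. ennreal (gaussian_density x) * indicator (Pi\<^sub>E B A) (\<lambda>b\<in>B. x $ u b) \<partial>(lborel :: (real^'m) measure))"
      using Q by (subst emeasure_density) (simp_all add: indicator_vimage)
    also have "\<dots> = (\<integral>\<^sup>+ x. (\<Prod>j\<in>UNIV. ennreal (std_normal_density (x $ j)) * indicator (A (v j)) (x $ j)) \<partial>(lborel :: (real^'m) measure))"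
    proof (rule nn_integral_cong)
      fix x :: "real^'m"
      have "indicator (Pi\<^sub>E B A) (\<lambda>b\<in>B. x $ u b) = (\<Prod>j\<in>UNIV. indicator (A (v j)) (x $ j) :: ennreal)"
      proof -
        have "(\<lambda>b\<in>B. x $ u b) \<in> Pi\<^sub>E B A \<longleftrightarrow> (\<forall>j. x $ j \<in> A (v j))"
          unfolding restrict_PiE_iff using vB vu uv by metis
        then show ?thesis
          by (auto simp: indicator_def prod_zero_iff)
      qed
      then show "ennreal (gaussian_density x) * indicator (Pi\<^sub>E B A) (\<lambda>b\<in>B. x $ u b) =
          (\<Prod>j\<in>UNIV. ennreal (std_normal_density (x $ j)) * indicator (A (v j)) (x $ j))"
        by (simp add: gaussian_density_def prod_ennreal prod.distrib)
    qed
    also have "\<dots> = (\<Prod>j\<in>UNIV. \<integral>\<^sup>+ s. ennreal (std_normal_density s) * indicator (A (v j)) s \<partial>lborel)"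
      using A by (intro nn_integral_lborel_vec_prod borel_measurable_times borel_measurable_indicator) simp_all
    also have "\<dots> = (\<Prod>j\<in>UNIV. emeasure ?N (A (v j)))"
      using A by (simp add: emeasure_density)
    also have "\<dots> = (\<Prod>b\<in>B. emeasure ?N (A b))"
      using prod.reindex_bij_betw[OF v, of "\<lambda>b. emeasure ?N (A b)"] .
    finally show "emeasure P (Pi\<^sub>E B A) = (\<Prod>b\<in>B. emeasure ?N (A b))" .
  qed simp
  \<comment> \<open>Independence says exactly that the joint law is the product of the marginal
    laws.\<close>
  moreover have "distr M (\<Pi>\<^sub>M b\<in>B. borel) (\<lambda>\<omega>. \<lambda>b\<in>B. G \<omega> \<bullet> b) = (\<Pi>\<^sub>M b\<in>B. ?N)"
  proof -
    have "distr M borel (\<lambda>\<omega>. G \<omega> \<bullet> b) = ?N" if "b \<in> B" for b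
    proof -
      have "distr M borel (\<lambda>\<omega>. G \<omega> \<bullet> b) = distr M lborel (\<lambda>\<omega>. G \<omega> \<bullet> b)"
        by (rule distr_cong) auto
      then show ?thesis
        using distributed_distr_eq_density[OF normal[OF that]] by simp
    qed
    then show ?thesis
      using indep_vars_iff_distr_eq_PiM'[OF \<open>B \<noteq> {}\<close>, of "\<lambda>b \<omega>. G \<omega> \<bullet> b" "\<lambda>_. borel"] indep
      by (auto cong: PiM_cong)
  qed
  ultimately have law: "distr M (\<Pi>\<^sub>M b\<in>B. borel) (\<lambda>\<omega>. \<lambda>b\<in>B. G \<omega> \<bullet> b) = P"
    by simp
  have "(\<integral>\<^sup>+ \<omega>. F (G \<omega>) \<partial>M) =
      (\<integral>\<^sup>+ x. F (\<Sum>j\<in>UNIV. x $ j *\<^sub>R v j) * ennreal (gaussian_density x) \<partial>(lborel :: (real^'m) measure))"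
    if [measurable]: "F \<in> borel_measurable borel" for F :: "'a \<Rightarrow> ennreal"
  proof -
    have K [measurable]: "(\<lambda>f. F (\<Sum>b\<in>B. f b *\<^sub>R b)) \<in> borel_measurable (\<Pi>\<^sub>M b\<in>B. borel)"
      by measurable
    have m: "(\<lambda>\<omega>. \<lambda>b\<in>B. G \<omega> \<bullet> b) \<in> M \<rightarrow>\<^sub>M (\<Pi>\<^sub>M b\<in>B. borel)"
      by measurable
    have coords': "(\<lambda>x. \<lambda>b\<in>B. x $ u b) \<in> density (lborel :: (real^'m) measure) (\<lambda>x. ennreal (gaussian_density x))
        \<rightarrow>\<^sub>M (\<Pi>\<^sub>M b\<in>B. borel)"
      using coords by simp
    \<comment> \<open>Almost surely \<open>G\<close> lies in \<open>E\<close> and equals its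
      expansion in \<open>B\<close>, so the integrand depends on the coordinates alone.\<close>
    have "(\<integral>\<^sup>+ \<omega>. F (G \<omega>) \<partial>M) = (\<integral>\<^sup>+ \<omega>. F (\<Sum>b\<in>B. (\<lambda>b\<in>B. G \<omega> \<bullet> b) b *\<^sub>R b) \<partial>M)"
      using G_E
    proof (intro nn_integral_cong_AE, eventually_elim)
      fix \<omega> assume "G \<omega> \<in> E"
      then have "(\<Sum>b\<in>B. (G \<omega> \<bullet> b) *\<^sub>R b) = G \<omega>"
        using orthonormal_basis_expand[OF ortho unit _ fin] span by blast
      then show "F (G \<omega>) = F (\<Sum>b\<in>B. (\<lambda>b\<in>B. G \<omega> \<bullet> b) b *\<^sub>R b)"
        by simp
    qed
    also have "\<dots> = (\<integral>\<^sup>+ f. F (\<Sum>b\<in>B. f b *\<^sub>R b) \<partial>distr M (\<Pi>\<^sub>M b\<in>B. borel) (\<lambda>\<omega>. \<lambda>b\<in>B. G \<omega> \<bullet> b))"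
      by (rule nn_integral_distr[OF m, symmetric]) (simp add: K)
    also have "\<dots> = (\<integral>\<^sup>+ x. F (\<Sum>b\<in>B. (\<lambda>b\<in>B. x $ u b) b *\<^sub>R b) * ennreal (gaussian_density x) \<partial>(lborel :: (real^'m) measure))"
    proof -
      have "(\<lambda>x :: real^'m. F (\<Sum>b\<in>B. (\<lambda>b\<in>B. x $ u b) b *\<^sub>R b)) \<in> borel_measurable lborel"
        using measurable_compose[OF coords K] by simp
      then show ?thesis
        unfolding law P_def
        by (subst nn_integral_distr[OF coords']) (simp_all only: K measurable_distr_eq1, subst nn_integral_density, simp_all add: mult.commute)
    qed
    also have "(\<lambda>x. \<Sum>b\<in>B. (\<lambda>b\<in>B. x $ u b) b *\<^sub>R b) = (\<lambda>x :: real^'m. \<Sum>j\<in>UNIV. x $ j *\<^sub>R v j)"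
    proof
      fix x :: "real^'m"
      show "(\<Sum>b\<in>B. (\<lambda>b\<in>B. x $ u b) b *\<^sub>R b) = (\<Sum>j\<in>UNIV. x $ j *\<^sub>R v j)"
        using sum.reindex_bij_betw[OF v, of "\<lambda>b. (\<lambda>b\<in>B. x $ u b) b *\<^sub>R b"] by (simp add: uv vB)
    qed
    finally show ?thesis .
  qed
  with \<open>orthonormal_family v\<close> show ?thesis
    by blast
qed


abbreviation power_sum :: "real \<Rightarrow> real^'n \<Rightarrow> real" where
  "power_sum p x \<equiv> \<Sum>i\<in>UNIV. \<bar>x $ i\<bar> powr p"

text \<open>A single point is null for a law with a density, and the synthesis map vanishes only at
  the origin. This matters because \<open>0 powr a = 0\<close> would break identities for exponents
  that are zero or negative.\<close>

lemma std_gaussian_on_nonzero: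
  fixes E :: "'a::euclidean_space set"
  assumes G: "std_gaussian_on M E G" and dim: "dim E = CARD('m::finite)"
  shows "AE \<omega> in M. G \<omega> \<noteq> 0"
proof -
  obtain v :: "'m \<Rightarrow> 'a" where v: "orthonormal_family v"
    and int: "\<And>F. F \<in> borel_measurable borel \<Longrightarrow> (\<integral>\<^sup>+ \<omega>. F (G \<omega>) \<partial>M) =
      (\<integral>\<^sup>+ x. F (\<Sum>j\<in>UNIV. x $ j *\<^sub>R v j) * ennreal (gaussian_density x) \<partial>(lborel :: (real^'m) measure))"
    using std_gaussian_on_nn_integral[OF G dim] by blast
  have [measurable]: "G \<in> borel_measurable M"
    using G by (simp add: std_gaussian_on_def)
  have "(\<Sum>j\<in>UNIV. x $ j *\<^sub>R v j) = 0 \<longleftrightarrow> x = 0" for x :: "real^'m"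
    using orthonormal_family_inner_sum[OF v, of x] by (metis inner_eq_zero_iff)
  then have "(\<integral>\<^sup>+ \<omega>. indicator {0} (G \<omega>) \<partial>M) =
      (\<integral>\<^sup>+ x. indicator {0} x * ennreal (gaussian_density x) \<partial>(lborel :: (real^'m) measure))"
    by (subst int) (simp_all add: indicator_def)
  also have "\<dots> = 0"
    using AE_lborel_singleton[of "0 :: real^'m"]
    by (subst nn_integral_0_iff_AE) (auto elim!: eventually_mono)
  finally have "AE \<omega> in M. indicator {0} (G \<omega>) = (0 :: ennreal)"
    by (subst (asm) nn_integral_0_iff_AE) simp_all
  then show ?thesis
    by (rule eventually_mono) (auto simp: indicator_def)
qed

section \<open>Laplace transforms of power sums\<close>

lemma nn_integral_powr_laplace_vec:
  assumes "0 \<le> t"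
  shows "(\<integral>\<^sup>+ x. ennreal (exp (- t * power_sum p x) * gaussian_density x) \<partial>(lborel :: (real^'m) measure))
    = ennreal (normal_laplace p t ^ CARD('m))"
proof -
  have "(\<integral>\<^sup>+ x. ennreal (exp (- t * power_sum p x) * gaussian_density x) \<partial>(lborel :: (real^'m) measure)) =
    (\<integral>\<^sup>+ x. (\<Prod>j\<in>UNIV. ennreal (exp (- t * \<bar>x $ j\<bar> powr p) * std_normal_density (x $ j))) \<partial>(lborel :: (real^'m) measure))"
    by (simp add: gaussian_density_def prod_ennreal prod.distrib exp_sum sum_distrib_left flip: sum_negf)
  also have "\<dots> = (\<Prod>j\<in>(UNIV :: 'm set). ennreal (normal_laplace p t))"
    using nn_integral_lborel_vec_prod[of "\<lambda>(_::'m) s. ennreal (exp (- t * \<bar>s\<bar> powr p) * std_normal_density s)"]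
    by (simp only: nn_integral_normal_laplace[OF assms]) simp
  also have "\<dots> = ennreal (normal_laplace p t ^ CARD('m))"
    using normal_laplace_pos[OF assms, of p] by (simp add: ennreal_power)
  finally show ?thesis .
qed

lemma integrable_powr_laplace_vec:
  assumes "0 \<le> t"
  shows "integrable lborel (\<lambda>x :: real^'m. exp (- t * power_sum p x) * gaussian_density x)"
  by (rule integrableI_nonneg)
    (simp_all add: nn_integral_powr_laplace_vec[OF assms, simplified] gaussian_density_pos less_imp_le)

text \<open>Orthogonal invariance from the one-sided substitution rule alone: it is applied to the
  function \<open>\<lambda>x. h (Q x)\<close> and the inverse of \<open>Q\<close>.\<close>

lemma nn_integral_orthogonal_ge:
  fixes h :: "real^'m::{finite,wellorder} \<Rightarrow> real" and Q :: "real^'m::_ \<Rightarrow> real^'m::_"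
  assumes h: "integrable lborel h" "\<And>x. 0 \<le> h x" and Q: "orthogonal_transformation Q"
  shows "(\<integral>\<^sup>+ x. ennreal (h x) \<partial>lborel) \<le> (\<integral>\<^sup>+ x. ennreal (h (Q x)) \<partial>lborel)"
proof -
  have meas_Q: "T \<in> borel_measurable borel" if "orthogonal_transformation T" for T :: "real^'m::_ \<Rightarrow> real^'m::_"
    using that by (intro borel_measurable_continuous_onI linear_continuous_on)
      (simp add: orthogonal_transformation_def linear_conv_bounded_linear)
  have le: "(\<integral>\<^sup>+ x. ennreal (k (T x)) \<partial>lborel) \<le> (\<integral>\<^sup>+ x. ennreal (k x) \<partial>lborel)"
    if k: "integrable lborel k" "\<And>x. 0 \<le> k x" and T: "orthogonal_transformation T"
    for k :: "real^'m::_ \<Rightarrow> real" and T :: "real^'m::_ \<Rightarrow> real^'m::_"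
  proof -
    have "(T has_derivative T) (at x)" for x
      using T by (intro linear_imp_has_derivative) (simp add: orthogonal_transformation_def)
    then show ?thesis
      using nn_integral_substitution_le[OF k, of T "\<lambda>_. T"] orthogonal_transformation_inj[OF T]
        orthogonal_transformation_det[OF T] by simp
  qed
  \<comment> \<open>The rule for \<open>Q\<close> itself supplies the integrability that the rule
    for its inverse demands.\<close>
  have "integrable lborel (\<lambda>x. h (Q x))"
  proof (rule integrableI_nonneg)
    show "(\<lambda>x. h (Q x)) \<in> borel_measurable lborel"
      using measurable_compose[OF meas_Q[OF Q], of h borel] borel_measurable_integrable[OF h(1)] by simp
    have "(\<integral>\<^sup>+ x. ennreal (h (Q x)) \<partial>lborel) \<le> (\<integral>\<^sup>+ x. ennreal (h x) \<partial>lborel)"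
      by (rule le[OF h Q])
    also have "\<dots> < \<infinity>"
      using h by (simp add: nn_integral_eq_integral)
    finally show "(\<integral>\<^sup>+ x. ennreal (h (Q x)) \<partial>lborel) < \<infinity>" .
  qed (simp add: h(2))
  from le[OF this _ orthogonal_transformation_inv[OF Q]] show ?thesis
    using orthogonal_transformation_surj[OF Q] h(2) by (simp add: surj_f_inv_f)
qed

text \<open>The coordinates of \<open>H\<close> refer to an unknown orthonormal basis
  \<open>v\<close>, whereas the power sum refers to the standard one. The change of basis is
  orthogonal and preserves the Gaussian density, which leads to the integral that factors.\<close>

lemma std_gaussian_on_UNIV_laplace_ge:
  fixes H :: "'w \<Rightarrow> real^'k"
  assumes H: "std_gaussian_on N UNIV H" and t: "0 \<le> t"
  shows "ennreal (normal_laplace p t ^ CARD('k)) \<le> (\<integral>\<^sup>+ \<omega>. ennreal (exp (- t * power_sum p (H \<omega>))) \<partial>N)"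
proof -
  have "dim (UNIV :: (real^'k) set) = CARD('k ordcopy)"
    by (simp add: CARD_ordcopy)
  from std_gaussian_on_nn_integral[OF H this]
  obtain v :: "'k ordcopy \<Rightarrow> real^'k" where v: "orthonormal_family v"
    and int: "\<And>F. F \<in> borel_measurable borel \<Longrightarrow> (\<integral>\<^sup>+ \<omega>. F (H \<omega>) \<partial>N) =
      (\<integral>\<^sup>+ x. F (\<Sum>j\<in>UNIV. x $ j *\<^sub>R v j) * ennreal (gaussian_density x) \<partial>(lborel :: (real^'k ordcopy) measure))"
    by blast
  obtain \<pi> :: "'k ordcopy \<Rightarrow> 'k" where \<pi>: "bij \<pi>"
    using finite_same_card_bij[of "UNIV :: 'k ordcopy set" "UNIV :: 'k set"] by (auto simp: CARD_ordcopy)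
  define L where "L x = (\<Sum>j\<in>UNIV. x $ j *\<^sub>R v j)" for x :: "real^'k ordcopy"
  \<comment> \<open>Relabelling by \<open>\<pi>\<close>, which does not affect power sums, turns the
    change of basis into a self-map of the space over the well-ordered index type.\<close>
  define Q :: "real^'k ordcopy \<Rightarrow> real^'k ordcopy" where "Q x = (\<chi> j. L x $ \<pi> j)" for x
  have reindex: "(\<Sum>j\<in>UNIV. K (\<pi> j)) = (\<Sum>i\<in>UNIV. K i)" for K :: "'k \<Rightarrow> real"
    using sum.reindex_bij_betw[OF \<pi>, of K] .
  have "linear L"
    unfolding L_def by (intro linearI) (simp_all add: algebra_simps sum.distrib scaleR_sum_right)
  have inner_Q: "Q x \<bullet> Q x = x \<bullet> x" for x
  proof -
    have "Q x \<bullet> Q x = L x \<bullet> L x"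
      using reindex[of "\<lambda>i. L x $ i * L x $ i"] by (simp add: inner_vec_def Q_def)
    then show ?thesis
      using orthonormal_family_inner_sum[OF v] by (simp add: L_def)
  qed
  have Q: "orthogonal_transformation Q"
    unfolding orthogonal_transformation
  proof
    show "linear Q"
      by (intro linearI) (simp_all add: Q_def vec_eq_iff linear_add[OF \<open>linear L\<close>] linear_scale[OF \<open>linear L\<close>])
    show "\<forall>x. norm (Q x) = norm x"
      by (simp add: norm_eq_sqrt_inner inner_Q)
  qed
  let ?h = "\<lambda>x :: real^'k ordcopy. exp (- t * power_sum p x) * gaussian_density x"
  have "ennreal (normal_laplace p t ^ CARD('k)) = (\<integral>\<^sup>+ x. ennreal (?h x) \<partial>lborel)"
    by (simp only: nn_integral_powr_laplace_vec[OF t] CARD_ordcopy)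
  also have "\<dots> \<le> (\<integral>\<^sup>+ x. ennreal (?h (Q x)) \<partial>lborel)"
    by (rule nn_integral_orthogonal_ge[OF integrable_powr_laplace_vec[OF t] _ Q])
      (simp add: gaussian_density_pos less_imp_le)
  also have "\<dots> = (\<integral>\<^sup>+ x. ennreal (exp (- t * power_sum p (L x))) * ennreal (gaussian_density x) \<partial>lborel)"
  proof (rule nn_integral_cong)
    fix x
    have "power_sum p (Q x) = power_sum p (L x)"
      using reindex[of "\<lambda>i. \<bar>L x $ i\<bar> powr p"] by (simp add: Q_def)
    moreover have "gaussian_density (Q x) = gaussian_density x"
      by (simp add: gaussian_density_eq inner_Q)
    ultimately show "ennreal (?h (Q x)) = ennreal (exp (- t * power_sum p (L x))) * ennreal (gaussian_density x)"
      by (simp add: ennreal_mult')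
  qed
  also have "\<dots> = (\<integral>\<^sup>+ \<omega>. ennreal (exp (- t * power_sum p (H \<omega>))) \<partial>N)"
    unfolding L_def by (rule int[symmetric]) measurable
  finally show ?thesis .
qed

text \<open>In the coordinates \<open>x\<close>, the \<open>i\<close>-th entry of \<open>G\<close>
  is \<open>x \<bullet> w i\<close>, where \<open>w i\<close> lists the coordinates along
  \<open>v\<close> of the projected \<open>i\<close>-th standard basis vector. The Brascamp-Lieb
  inequality reduces the claim to \<open>normal_laplace_prod_le\<close>.\<close>

lemma std_gaussian_on_laplace_le:
  fixes G :: "'v \<Rightarrow> real^'n" and E :: "(real^'n) set"
  assumes G: "std_gaussian_on M E G" and dim: "dim E = CARD('k::finite)"
    and p: "2 \<le> p" and t: "0 \<le> t"
  shows "(\<integral>\<^sup>+ \<omega>. ennreal (exp (- t * power_sum p (G \<omega>))) \<partial>M)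
    \<le> ennreal (normal_laplace p (t * (real CARD('k) / real CARD('n)) powr ((p - 2) / 2)) ^ CARD('k))"
proof -
  let ?q = "(p - 2) / 2"
  have "dim E = CARD('k ordcopy)"
    by (simp add: CARD_ordcopy dim)
  from std_gaussian_on_nn_integral[OF G this]
  obtain v :: "'k ordcopy \<Rightarrow> real^'n" where v: "orthonormal_family v"
    and int: "\<And>F. F \<in> borel_measurable borel \<Longrightarrow> (\<integral>\<^sup>+ \<omega>. F (G \<omega>) \<partial>M) =
      (\<integral>\<^sup>+ x. F (\<Sum>j\<in>UNIV. x $ j *\<^sub>R v j) * ennreal (gaussian_density x) \<partial>(lborel :: (real^'k ordcopy) measure))"
    by blast
  define w :: "'n \<Rightarrow> real^'k ordcopy" where "w i = (\<chi> j. v j $ i)" for i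
  \<comment> \<open>Vanishing \<open>w i\<close> have no direction; dropping them changes neither
    the frame identity nor the sum of the \<open>c i\<close>.\<close>
  define I where "I = {i. w i \<noteq> 0}"
  define c where "c i = (norm (w i))\<^sup>2" for i
  have nth: "(\<Sum>j\<in>UNIV. x $ j *\<^sub>R v j) $ i = x \<bullet> w i" for x i
    by (simp add: w_def inner_vec_def)
  have frame: "(\<Sum>i\<in>I. (x \<bullet> w i)\<^sup>2) = x \<bullet> x" for x
  proof -
    have "(\<Sum>i\<in>I. (x \<bullet> w i)\<^sup>2) = (\<Sum>i\<in>UNIV. (x \<bullet> w i)\<^sup>2)"
      by (rule sum.mono_neutral_left) (auto simp: I_def)
    also have "\<dots> = (\<Sum>j\<in>UNIV. x $ j *\<^sub>R v j) \<bullet> (\<Sum>j\<in>UNIV. x $ j *\<^sub>R v j)"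
      by (subst inner_vec_def) (simp add: nth power2_eq_square del: sum_component)
    finally show ?thesis
      using orthonormal_family_inner_sum[OF v] by simp
  qed
  \<comment> \<open>The trace of the projection: squared entries are summed by rows and then by
    columns.\<close>
  have "sum c I = (\<Sum>i\<in>UNIV. c i)"
    by (rule sum.mono_neutral_left) (auto simp: I_def c_def)
  also have "\<dots> = (\<Sum>i\<in>UNIV. \<Sum>j\<in>UNIV. v j $ i * v j $ i)"
    by (simp add: c_def w_def power2_norm_eq_inner inner_vec_def)
  also have "\<dots> = (\<Sum>j\<in>UNIV. v j \<bullet> v j)"
    by (subst sum.swap) (simp add: inner_vec_def)
  also have "\<dots> = real CARD('k)"
    using v by (simp add: orthonormal_family_def CARD_ordcopy)
  finally have sum_c: "sum c I = real CARD('k)" .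
  have c_pos: "0 < c i" if "i \<in> I" for i
    using that by (simp add: c_def I_def)
  \<comment> \<open>The factor \<open>c i powr ?q\<close> makes the outer power \<open>c i\<close>
    and the division by \<open>norm (w i)\<close> cancel:
    \<open>c i powr ?q * c i = norm (w i) powr p\<close>.\<close>
  let ?f = "\<lambda>i s. exp (- (t * c i powr ?q) * \<bar>s\<bar> powr p)"
  have \<mu>: "0 \<le> t * c i powr ?q" for i
    using t by simp
  have "(\<integral>\<^sup>+ \<omega>. ennreal (exp (- t * power_sum p (G \<omega>))) \<partial>M) =
      (\<integral>\<^sup>+ x. ennreal (exp (- t * (\<Sum>i\<in>UNIV. \<bar>x \<bullet> w i\<bar> powr p))) * ennreal (gaussian_density x) \<partial>lborel)"
    by (subst int) (simp_all add: nth del: sum_component)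
  also have "\<dots> = (\<integral>\<^sup>+ x. ennreal ((\<Prod>i\<in>I. ?f i (x \<bullet> w i / norm (w i)) powr (norm (w i))\<^sup>2) * gaussian_density x) \<partial>lborel)"
  proof (rule nn_integral_cong)
    fix x
    have "?f i (x \<bullet> w i / norm (w i)) powr (norm (w i))\<^sup>2 = exp (- t * \<bar>x \<bullet> w i\<bar> powr p)" if "i \<in> I" for i
    proof -
      have n: "0 < norm (w i)"
        using that by (simp add: I_def)
      have 1: "c i powr ?q * c i = norm (w i) powr p"
      proof -
        have c_eq: "c i = norm (w i) powr 2"
          using n by (simp add: c_def)
        show ?thesis
          unfolding c_eq powr_powr powr_add[symmetric] by (simp add: field_simps)
      qed
      have 2: "\<bar>x \<bullet> w i / norm (w i)\<bar> powr p = \<bar>x \<bullet> w i\<bar> powr p / norm (w i) powr p"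
        using n by (simp add: abs_divide powr_divide)
      have "c i powr ?q * \<bar>x \<bullet> w i / norm (w i)\<bar> powr p * c i
          = (c i powr ?q * c i) * \<bar>x \<bullet> w i / norm (w i)\<bar> powr p"
        by (simp only: mult_ac)
      also have "\<dots> = \<bar>x \<bullet> w i\<bar> powr p"
        unfolding 1 2 using n by simp
      finally have "c i powr ?q * \<bar>x \<bullet> w i / norm (w i)\<bar> powr p * c i = \<bar>x \<bullet> w i\<bar> powr p" .
      then show ?thesis
        by (simp add: exp_powr_real mult.assoc flip: c_def)
    qed
    then have "(\<Prod>i\<in>I. ?f i (x \<bullet> w i / norm (w i)) powr (norm (w i))\<^sup>2) = exp (\<Sum>i\<in>I. - t * \<bar>x \<bullet> w i\<bar> powr p)"
      by (simp add: exp_sum I_def)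
    also have "(\<Sum>i\<in>I. - t * \<bar>x \<bullet> w i\<bar> powr p) = (\<Sum>i\<in>UNIV. - t * \<bar>x \<bullet> w i\<bar> powr p)"
      by (rule sum.mono_neutral_left) (auto simp: I_def)
    finally show "ennreal (exp (- t * (\<Sum>i\<in>UNIV. \<bar>x \<bullet> w i\<bar> powr p))) * ennreal (gaussian_density x) =
        ennreal ((\<Prod>i\<in>I. ?f i (x \<bullet> w i / norm (w i)) powr (norm (w i))\<^sup>2) * gaussian_density x)"
      by (simp add: sum_distrib_left ennreal_mult')
  qed
  also have "\<dots> \<le> ennreal (\<Prod>i\<in>I. normal_laplace p (t * c i powr ?q) powr (norm (w i))\<^sup>2)"
  proof (rule geometric_Brascamp_Lieb[OF _ _ frame])
    show "continuous_on UNIV (?f i)" for i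
      using p by (intro continuous_exp_powr) simp
    show "0 < normal_laplace p (t * c i powr ?q)" for i
      by (rule normal_laplace_pos[OF \<mu>])
    show "(\<integral>\<^sup>+ s. ennreal (?f i s * std_normal_density s) \<partial>lborel) = ennreal (normal_laplace p (t * c i powr ?q))" for i
      by (rule nn_integral_normal_laplace[OF \<mu>])
  qed (auto simp: I_def)
  also have "\<dots> = ennreal (\<Prod>i\<in>I. normal_laplace p (t * c i powr ?q) powr c i)"
    by (simp add: c_def)
  also have "\<dots> \<le> ennreal (normal_laplace p (t * (real CARD('k) / real CARD('n)) powr ?q) powr real CARD('k))"
    using p t c_pos sum_c
    by (intro ennreal_leI normal_laplace_prod_le) (auto simp: card_mono)
  also have "\<dots> = ennreal (normal_laplace p (t * (real CARD('k) / real CARD('n)) powr ?q) ^ CARD('k))"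
    using normal_laplace_pos[of "t * (real CARD('k) / real CARD('n)) powr ?q" p] t by (simp add: powr_realpow)
  finally show ?thesis .
qed

lemma std_gaussian_on_laplace_comparison:
  fixes G :: "'v \<Rightarrow> real^'n" and E :: "(real^'n) set" and H :: "'w \<Rightarrow> real^'k"
  assumes G: "std_gaussian_on M E G" and dim: "dim E = CARD('k)"
    and H: "std_gaussian_on N UNIV H" and p: "2 \<le> p" and t: "0 \<le> t"
  shows "(\<integral>\<^sup>+ \<omega>. ennreal (exp (- t * power_sum p (G \<omega>))) \<partial>M)
    \<le> (\<integral>\<^sup>+ \<omega>. ennreal (exp (- t * ((real CARD('k) / real CARD('n)) powr ((p - 2) / 2) * power_sum p (H \<omega>)))) \<partial>N)"
  using order_trans[OF std_gaussian_on_laplace_le[OF G dim p t] std_gaussian_on_UNIV_laplace_ge[OF H]] t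
  by (simp add: mult.assoc)

section \<open>Consequences of the domination of Laplace transforms\<close>

lemma nn_integral_powr_scale:
  fixes \<phi> :: "real \<Rightarrow> real"
  assumes [measurable]: "\<phi> \<in> borel_measurable borel" and x: "0 < x"
  shows "(\<integral>\<^sup>+ s. ennreal (s powr e * \<phi> (s * x)) * indicator {0<..} s \<partial>lborel)
    = ennreal (x powr (- 1 - e)) * (\<integral>\<^sup>+ s. ennreal (s powr e * \<phi> s) * indicator {0<..} s \<partial>lborel)"
proof -
  have "(\<integral>\<^sup>+ s. ennreal (s powr e * \<phi> s) * indicator {0<..} s \<partial>lborel)
      = ennreal x * (\<integral>\<^sup>+ s. ennreal ((x * s) powr e * \<phi> (x * s)) * indicator {0<..} (x * s) \<partial>lborel)"
    using x by (subst nn_integral_real_affine[where c=x and t=0]) simp_all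
  also have "(\<integral>\<^sup>+ s. ennreal ((x * s) powr e * \<phi> (x * s)) * indicator {0<..} (x * s) \<partial>lborel)
      = (\<integral>\<^sup>+ s. ennreal (x powr e) * (ennreal (s powr e * \<phi> (s * x)) * indicator {0<..} s) \<partial>lborel)"
    using x by (intro nn_integral_cong) 
      (auto simp: indicator_def powr_mult zero_less_mult_iff mult_ac simp flip: ennreal_mult')
  also have "\<dots> = ennreal (x powr e) * (\<integral>\<^sup>+ s. ennreal (s powr e * \<phi> (s * x)) * indicator {0<..} s \<partial>lborel)"
    by (rule nn_integral_cmult) measurable
  finally have "ennreal (x powr (- 1 - e)) * (\<integral>\<^sup>+ s. ennreal (s powr e * \<phi> s) * indicator {0<..} s \<partial>lborel)
      = ennreal (x powr (- 1 - e) * (x * x powr e)) * (\<integral>\<^sup>+ s. ennreal (s powr e * \<phi> (s * x)) * indicator {0<..} s \<partial>lborel)"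
    using x by (simp add: ennreal_mult' mult.assoc)
  moreover have "x powr (- 1 - e) * (x * x powr e) = 1"
  proof -
    have "x powr (- 1 - e) * (x powr 1 * x powr e) = 1"
      unfolding powr_add[symmetric] using x by simp
    then show ?thesis
      using x by simp
  qed
  ultimately show ?thesis
    by simp
qed

lemma nn_integral_Gamma:
  fixes a x :: real
  assumes "0 < a" "0 < x"
  shows "(\<integral>\<^sup>+ s. ennreal (s powr (a - 1) * exp (- (s * x))) * indicator {0<..} s \<partial>lborel)
    = ennreal (Gamma a) * ennreal (x powr (- a))"
proof -
  have "(\<integral>\<^sup>+ s. ennreal (s powr (a - 1) * exp (- s)) * indicator {0<..} s \<partial>lborel)
      = (\<integral>\<^sup>+ s. ennreal (s powr (a - 1) / exp s) * indicator {0..} s \<partial>lborel)"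
    by (intro nn_integral_cong) (auto simp: indicator_def exp_minus field_simps)
  also have "\<dots> = ennreal (Gamma a)"
    using Gamma_integral_real[OF assms(1)] by (intro nn_integral_has_integral_lebesgue') auto
  finally show ?thesis
    using nn_integral_powr_scale[of "\<lambda>u. exp (- u)" x "a - 1"] assms(2) by (simp add: mult.commute)
qed

text \<open>The Levy-Khintchine representation of the Bernstein function
  \<open>x powr \<theta>\<close>. By scaling, only the integral at \<open>x = 1\<close> has to be
  finite and positive: near \<open>0\<close> the bound \<open>1 - exp (- s) \<le> s\<close> leaves
  \<open>s powr (- \<theta>)\<close>, integrable as \<open>\<theta> < 1\<close>, and beyond
  \<open>1\<close> the weight itself is integrable as \<open>\<theta> > 0\<close>.\<close>

lemma nn_integral_Bernstein_powr:
  fixes \<theta> :: real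
  assumes \<theta>: "0 < \<theta>" "\<theta> < 1"
  obtains c where "0 < c" "\<And>x. 0 \<le> x \<Longrightarrow>
    (\<integral>\<^sup>+ s. ennreal (s powr (- 1 - \<theta>) * (1 - exp (- (s * x)))) * indicator {0<..} s \<partial>lborel) = ennreal (c * x powr \<theta>)"
proof -
  let ?K = "\<integral>\<^sup>+ s. ennreal (s powr (- 1 - \<theta>) * (1 - exp (- s))) * indicator {0<..} s \<partial>lborel"
  have "?K \<le> (\<integral>\<^sup>+ s. ennreal (s powr (- \<theta>)) * indicator {0..1} s + ennreal (s powr (- 1 - \<theta>)) * indicator {1..} s \<partial>lborel)"
  proof (rule nn_integral_mono)
    fix s :: real
    consider "s \<le> 0" | "0 < s" "s \<le> 1" | "1 < s"
      by linarith
    then show "ennreal (s powr (- 1 - \<theta>) * (1 - exp (- s))) * indicator {0<..} s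
        \<le> ennreal (s powr (- \<theta>)) * indicator {0..1} s + ennreal (s powr (- 1 - \<theta>)) * indicator {1..} s"
    proof cases
      case 2
      have "s powr (- 1 - \<theta>) * (1 - exp (- s)) \<le> s powr (- 1 - \<theta>) * s powr 1"
        using 2 exp_ge_add_one_self[of "- s"] by (intro mult_left_mono) auto
      also have "\<dots> = s powr (- \<theta>)"
        unfolding powr_add[symmetric] by simp
      finally have "ennreal (s powr (- 1 - \<theta>) * (1 - exp (- s))) \<le> ennreal (s powr (- \<theta>))"
        by (rule ennreal_leI)
      with 2 show ?thesis
        by (simp add: add_increasing2)
    next
      case 3
      have "s powr (- 1 - \<theta>) * (1 - exp (- s)) \<le> s powr (- 1 - \<theta>) * 1"
        by (intro mult_left_mono) auto
      then show ?thesis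
        using 3 by (simp add: ennreal_leI)
    qed simp
  qed
  also have "\<dots> = (\<integral>\<^sup>+ s. ennreal (s powr (- \<theta>)) * indicator {0..1} s \<partial>lborel) + (\<integral>\<^sup>+ s. ennreal (s powr (- 1 - \<theta>)) * indicator {1..} s \<partial>lborel)"
    by (rule nn_integral_add) measurable
  also have "(\<integral>\<^sup>+ s. ennreal (s powr (- \<theta>)) * indicator {0..1} s \<partial>lborel) = ennreal (1 powr (- \<theta> + 1) / (- \<theta> + 1))"
    using has_integral_powr_from_0[of "- \<theta>" 1] \<theta> by (intro nn_integral_has_integral_lebesgue') auto
  also have "(\<integral>\<^sup>+ s. ennreal (s powr (- 1 - \<theta>)) * indicator {1..} s \<partial>lborel) = ennreal (- (1 powr (- 1 - \<theta> + 1)) / (- 1 - \<theta> + 1))"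
    using has_integral_powr_to_inf[of "- 1 - \<theta>" 1] \<theta> by (intro nn_integral_has_integral_lebesgue') auto
  finally have "?K < \<infinity>"
    by (rule le_less_trans) simp
  moreover have "?K \<noteq> 0"
  proof
    assume "?K = 0"
    then have "AE s in lborel. ennreal (s powr (- 1 - \<theta>) * (1 - exp (- s))) * indicator {0<..} s = 0"
      by (subst (asm) nn_integral_0_iff_AE) measurable
    \<comment> \<open>The integrand is positive on \<open>{0<..1}\<close>, which has positive
      measure.\<close>
    then have "AE s in lborel. s \<notin> {0<..(1::real)}"
      by (rule eventually_mono) (auto simp: indicator_def ennreal_eq_0_iff mult_le_0_iff split: if_splits)
    then show False
      by (subst (asm) AE_iff_measurable[of "{0<..1}"]) auto
  qed
  ultimately obtain c where c: "0 < c" "?K = ennreal c"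
    by (cases ?K rule: ennreal_cases) (auto simp: less_le)
  show ?thesis
  proof (rule that[OF c(1)])
    fix x :: real assume "0 \<le> x"
    then consider "x = 0" | "0 < x"
      by linarith
    then show "(\<integral>\<^sup>+ s. ennreal (s powr (- 1 - \<theta>) * (1 - exp (- (s * x)))) * indicator {0<..} s \<partial>lborel) = ennreal (c * x powr \<theta>)"
    proof cases
      case 2
      then show ?thesis
        using nn_integral_powr_scale[of "\<lambda>u. 1 - exp (- u)" x "- 1 - \<theta>"] c by (simp add: ennreal_mult' mult.commute)
    qed simp
  qed
qed

text \<open>The Laplace transform order. Since it passes to powers \<open>\<theta>\<close> in the
  unit interval by \<open>laplace_dominated_powr\<close>, the moment inequalities are proved once
  here and reused for such powers.\<close>

locale laplace_dominated = M: prob_space M + N: prob_space N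
  for M :: "'a measure" and N :: "'b measure" +
  fixes X :: "'a \<Rightarrow> real" and Y :: "'b \<Rightarrow> real"
  assumes X_meas [measurable]: "X \<in> borel_measurable M" and Y_meas [measurable]: "Y \<in> borel_measurable N"
    and X_nonneg: "\<And>\<omega>. 0 \<le> X \<omega>" and Y_nonneg: "\<And>\<omega>. 0 \<le> Y \<omega>"
    and X_pos: "AE \<omega> in M. 0 < X \<omega>" and Y_pos: "AE \<omega> in N. 0 < Y \<omega>"
    and laplace: "\<And>t. 0 \<le> t \<Longrightarrow>
      (\<integral>\<^sup>+ \<omega>. ennreal (exp (- t * X \<omega>)) \<partial>M) \<le> (\<integral>\<^sup>+ \<omega>. ennreal (exp (- t * Y \<omega>)) \<partial>N)"
begin

text \<open>\<open>k n u\<close> tends to \<open>u\<close> from below, and its mean is a decreasing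
  affine function of the Laplace transform at \<open>1 / real (Suc n)\<close>. Fatou's lemma handles
  \<open>Y\<close> and \<open>k n u \<le> u\<close> handles \<open>X\<close>, so infinite means are
  covered.\<close>

lemma mean_ge: "(\<integral>\<^sup>+ \<omega>. ennreal (Y \<omega>) \<partial>N) \<le> (\<integral>\<^sup>+ \<omega>. ennreal (X \<omega>) \<partial>M)"
proof -
  define k where "k n u = real (Suc n) * (1 - exp (- (1 / real (Suc n)) * u))" for n u
  have k_nonneg: "0 \<le> k n u" if "0 \<le> u" for n u
    using that by (simp add: k_def)
  have k_le: "k n u \<le> u" for n u
  proof -
    have "1 - exp (- (1 / real (Suc n)) * u) \<le> (1 / real (Suc n)) * u"
      using exp_ge_add_one_self[of "- (1 / real (Suc n)) * u"] by simp
    then have "k n u \<le> real (Suc n) * ((1 / real (Suc n)) * u)"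
      unfolding k_def by (intro mult_left_mono) simp_all
    then show ?thesis
      by (simp del: of_nat_Suc)
  qed
  have k_lim: "(\<lambda>n. k n u) \<longlonglongrightarrow> u" for u
    unfolding k_def by real_asymp
  have int_k: "(\<integral>\<^sup>+ \<omega>. ennreal (k n (Z \<omega>)) \<partial>P) = ennreal (real (Suc n)) * (1 - (\<integral>\<^sup>+ \<omega>. ennreal (exp (- (1 / real (Suc n)) * Z \<omega>)) \<partial>P))"
    if P: "prob_space P" and [measurable]: "Z \<in> borel_measurable P" and Z: "\<And>\<omega>. 0 \<le> Z \<omega>" for P :: "'c measure" and Z n
  proof -
    interpret P: prob_space P by (rule P)
    have "(\<integral>\<^sup>+ \<omega>. ennreal (exp (- (1 / real (Suc n)) * Z \<omega>)) \<partial>P) \<le> (\<integral>\<^sup>+ \<omega>. 1 \<partial>P)"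
      using Z by (intro nn_integral_mono) simp
    then have fin: "(\<integral>\<^sup>+ \<omega>. ennreal (exp (- (1 / real (Suc n)) * Z \<omega>)) \<partial>P) \<noteq> \<infinity>"
      by (auto simp: P.emeasure_space_1 top_unique)
    have "(\<integral>\<^sup>+ \<omega>. ennreal (k n (Z \<omega>)) \<partial>P) =
        (\<integral>\<^sup>+ \<omega>. ennreal (real (Suc n)) * (1 - ennreal (exp (- (1 / real (Suc n)) * Z \<omega>))) \<partial>P)"
      by (simp only: k_def ennreal_mult' of_nat_0_le_iff ennreal_minus exp_ge_zero flip: ennreal_1)
    also have "\<dots> = ennreal (real (Suc n)) * (\<integral>\<^sup>+ \<omega>. 1 - ennreal (exp (- (1 / real (Suc n)) * Z \<omega>)) \<partial>P)"
      by (rule nn_integral_cmult) measurable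
    also have "(\<integral>\<^sup>+ \<omega>. 1 - ennreal (exp (- (1 / real (Suc n)) * Z \<omega>)) \<partial>P) = 1 - (\<integral>\<^sup>+ \<omega>. ennreal (exp (- (1 / real (Suc n)) * Z \<omega>)) \<partial>P)"
      using fin Z by (subst nn_integral_diff) (auto simp: P.emeasure_space_1)
    finally show ?thesis .
  qed
  have "(\<integral>\<^sup>+ \<omega>. ennreal (Y \<omega>) \<partial>N) = (\<integral>\<^sup>+ \<omega>. liminf (\<lambda>n. ennreal (k n (Y \<omega>))) \<partial>N)"
    by (intro nn_integral_cong lim_imp_Liminf[symmetric] tendsto_ennrealI k_lim) simp
  also have "\<dots> \<le> liminf (\<lambda>n. \<integral>\<^sup>+ \<omega>. ennreal (k n (Y \<omega>)) \<partial>N)"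
    by (rule nn_integral_liminf) (simp add: k_def)
  also have "\<dots> \<le> liminf (\<lambda>n. \<integral>\<^sup>+ \<omega>. ennreal (X \<omega>) \<partial>M)"
  proof (intro Liminf_mono always_eventually allI)
    fix n
    have "(\<integral>\<^sup>+ \<omega>. ennreal (k n (Y \<omega>)) \<partial>N) \<le> (\<integral>\<^sup>+ \<omega>. ennreal (k n (X \<omega>)) \<partial>M)"
      unfolding int_k[OF N.prob_space_axioms Y_meas Y_nonneg] int_k[OF M.prob_space_axioms X_meas X_nonneg]
      by (intro mult_left_mono ennreal_minus_mono laplace) simp_all
    also have "\<dots> \<le> (\<integral>\<^sup>+ \<omega>. ennreal (X \<omega>) \<partial>M)"
      by (intro nn_integral_mono ennreal_leI k_le)
    finally show "(\<integral>\<^sup>+ \<omega>. ennreal (k n (Y \<omega>)) \<partial>N) \<le> (\<integral>\<^sup>+ \<omega>. ennreal (X \<omega>) \<partial>M)" .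
  qed
  finally show ?thesis
    by (simp add: Liminf_const)
qed

text \<open>Integrate the Gamma integral for \<open>x powr (- a)\<close> over the probability space,
  exchange the integrals by Tonelli, and compare the Laplace transforms for each
  \<open>s\<close>.\<close>

lemma negative_moment_le:
  assumes "0 \<le> a"
  shows "(\<integral>\<^sup>+ \<omega>. ennreal (X \<omega> powr (- a)) \<partial>M) \<le> (\<integral>\<^sup>+ \<omega>. ennreal (Y \<omega> powr (- a)) \<partial>N)"
proof (cases "a = 0")
  case True
  \<comment> \<open>As \<open>0 powr 0 = 0\<close>, the left-hand integrand is only bounded by one,
    while the right-hand one equals one almost everywhere.\<close>
  have "(\<integral>\<^sup>+ \<omega>. ennreal (X \<omega> powr (- a)) \<partial>M) \<le> (\<integral>\<^sup>+ \<omega>. 1 \<partial>M)"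
    using True by (intro nn_integral_mono) (auto simp: powr_def)
  also have "\<dots> = (\<integral>\<^sup>+ \<omega>. 1 \<partial>N)"
    by (simp add: M.emeasure_space_1 N.emeasure_space_1)
  also have "\<dots> = (\<integral>\<^sup>+ \<omega>. ennreal (Y \<omega> powr (- a)) \<partial>N)"
    using Y_pos True by (intro nn_integral_cong_AE) (auto elim!: eventually_mono)
  finally show ?thesis .
next
  case False
  with assms have a: "0 < a"
    by simp
  have repr: "ennreal (Gamma a) * (\<integral>\<^sup>+ \<omega>. ennreal (Z \<omega> powr (- a)) \<partial>P) =
      (\<integral>\<^sup>+ s. ennreal (s powr (a - 1)) * indicator {0<..} s * (\<integral>\<^sup>+ \<omega>. ennreal (exp (- s * Z \<omega>)) \<partial>P) \<partial>lborel)"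
    if P: "prob_space P" and [measurable]: "Z \<in> borel_measurable P" and Z: "AE \<omega> in P. 0 < Z \<omega>" for P :: "'c measure" and Z
  proof -
    interpret P: prob_space P by (rule P)
    interpret pair_sigma_finite P "lborel :: real measure" ..
    have "ennreal (Gamma a) * (\<integral>\<^sup>+ \<omega>. ennreal (Z \<omega> powr (- a)) \<partial>P) = (\<integral>\<^sup>+ \<omega>. ennreal (Gamma a) * ennreal (Z \<omega> powr (- a)) \<partial>P)"
      by (rule nn_integral_cmult[symmetric]) measurable
    also have "\<dots> = (\<integral>\<^sup>+ \<omega>. \<integral>\<^sup>+ s. ennreal (s powr (a - 1)) * indicator {0<..} s * ennreal (exp (- s * Z \<omega>)) \<partial>lborel \<partial>P)"
      using Z
    proof (intro nn_integral_cong_AE, eventually_elim)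
      fix \<omega> assume "0 < Z \<omega>"
      from nn_integral_Gamma[OF a this]
      show "ennreal (Gamma a) * ennreal (Z \<omega> powr (- a)) =
          (\<integral>\<^sup>+ s. ennreal (s powr (a - 1)) * indicator {0<..} s * ennreal (exp (- s * Z \<omega>)) \<partial>lborel)"
        by (simp add: ennreal_mult' mult_ac)
    qed
    also have "\<dots> = (\<integral>\<^sup>+ s. \<integral>\<^sup>+ \<omega>. ennreal (s powr (a - 1)) * indicator {0<..} s * ennreal (exp (- s * Z \<omega>)) \<partial>P \<partial>lborel)"
      by (rule Fubini'[symmetric]) measurable
    also have "\<dots> = (\<integral>\<^sup>+ s. ennreal (s powr (a - 1)) * indicator {0<..} s * (\<integral>\<^sup>+ \<omega>. ennreal (exp (- s * Z \<omega>)) \<partial>P) \<partial>lborel)"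
      by (intro nn_integral_cong nn_integral_cmult) measurable
    finally show ?thesis .
  qed
  have "ennreal (Gamma a) * (\<integral>\<^sup>+ \<omega>. ennreal (X \<omega> powr (- a)) \<partial>M) \<le> ennreal (Gamma a) * (\<integral>\<^sup>+ \<omega>. ennreal (Y \<omega> powr (- a)) \<partial>N)"
    unfolding repr[OF M.prob_space_axioms X_meas X_pos] repr[OF N.prob_space_axioms Y_meas Y_pos]
  proof (rule nn_integral_mono)
    fix s :: real
    show "ennreal (s powr (a - 1)) * indicator {0<..} s * (\<integral>\<^sup>+ \<omega>. ennreal (exp (- s * X \<omega>)) \<partial>M)
        \<le> ennreal (s powr (a - 1)) * indicator {0<..} s * (\<integral>\<^sup>+ \<omega>. ennreal (exp (- s * Y \<omega>)) \<partial>N)"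
      using laplace[of s] by (cases "0 < s") (auto intro: mult_left_mono)
  qed
  then show ?thesis
    using Gamma_real_pos[OF a] by (subst (asm) ennreal_mult_le_mult_iff) auto
qed

text \<open>
  For a mixture \<open>h\<close> of exponentials, \<open>h\<^sup>m\<^sup>+\<^sup>1 exp (- \<tau> x)\<close> is a mixture of the functions \<open>h\<^sup>m exp (- (\<tau> + s) x)\<close>,
  so the comparison passes from \<open>h\<^sup>m\<close> to \<open>h\<^sup>m\<^sup>+\<^sup>1\<close> and then to \<open>exp (t h)\<close>.
\<close>

lemma mixture_power_le:
  fixes w :: "real \<Rightarrow> ennreal"
  assumes [measurable]: "w \<in> borel_measurable borel" and w: "\<And>s. s < 0 \<Longrightarrow> w s = 0" and \<tau>: "0 \<le> \<tau>"
  shows "(\<integral>\<^sup>+ \<omega>. (\<integral>\<^sup>+ s. w s * ennreal (exp (- s * X \<omega>)) \<partial>lborel) ^ m * ennreal (exp (- \<tau> * X \<omega>)) \<partial>M)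
    \<le> (\<integral>\<^sup>+ \<omega>. (\<integral>\<^sup>+ s. w s * ennreal (exp (- s * Y \<omega>)) \<partial>lborel) ^ m * ennreal (exp (- \<tau> * Y \<omega>)) \<partial>N)"
  using \<tau>
\<comment> \<open>\<open>\<tau>\<close> is generalized because the step from \<open>m\<close> to
  \<open>Suc m\<close> shifts it by \<open>s\<close>.\<close>
proof (induction m arbitrary: \<tau>)
  case 0
  then show ?case
    using laplace[OF 0] by simp
next
  case (Suc m)
  define h where "h x = (\<integral>\<^sup>+ s. w s * ennreal (exp (- s * x)) \<partial>lborel)" for x
  have [measurable]: "h \<in> borel_measurable borel"
    unfolding h_def by measurable
  have repr: "(\<integral>\<^sup>+ \<omega>. h (Z \<omega>) ^ Suc m * ennreal (exp (- \<tau> * Z \<omega>)) \<partial>P) =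
      (\<integral>\<^sup>+ s. w s * (\<integral>\<^sup>+ \<omega>. h (Z \<omega>) ^ m * ennreal (exp (- (\<tau> + s) * Z \<omega>)) \<partial>P) \<partial>lborel)"
    if P: "prob_space P" and [measurable]: "Z \<in> borel_measurable P" for P :: "'c measure" and Z
  proof -
    interpret P: prob_space P by (rule P)
    interpret pair_sigma_finite P "lborel :: real measure" ..
    have "h x ^ Suc m * ennreal (exp (- \<tau> * x)) = (\<integral>\<^sup>+ s. w s * (h x ^ m * ennreal (exp (- (\<tau> + s) * x))) \<partial>lborel)" for x
    proof -
      have "(\<integral>\<^sup>+ s. w s * (h x ^ m * ennreal (exp (- (\<tau> + s) * x))) \<partial>lborel) =
          (\<integral>\<^sup>+ s. (h x ^ m * ennreal (exp (- \<tau> * x))) * (w s * ennreal (exp (- s * x))) \<partial>lborel)"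
      proof (rule nn_integral_cong)
        fix s
        have "ennreal (exp (- (\<tau> + s) * x)) = ennreal (exp (- \<tau> * x)) * ennreal (exp (- s * x))"
          by (simp add: distrib_right exp_diff exp_minus field_simps flip: ennreal_mult' exp_add)
        then show "w s * (h x ^ m * ennreal (exp (- (\<tau> + s) * x))) =
            (h x ^ m * ennreal (exp (- \<tau> * x))) * (w s * ennreal (exp (- s * x)))"
          by (simp only: mult_ac)
      qed
      also have "\<dots> = (h x ^ m * ennreal (exp (- \<tau> * x))) * h x"
        unfolding h_def by (rule nn_integral_cmult) measurable
      finally show ?thesis
        by (simp add: mult_ac)
    qed
    then have "(\<integral>\<^sup>+ \<omega>. h (Z \<omega>) ^ Suc m * ennreal (exp (- \<tau> * Z \<omega>)) \<partial>P) =
        (\<integral>\<^sup>+ \<omega>. \<integral>\<^sup>+ s. w s * (h (Z \<omega>) ^ m * ennreal (exp (- (\<tau> + s) * Z \<omega>))) \<partial>lborel \<partial>P)"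
      by (simp only:)
    also have "\<dots> = (\<integral>\<^sup>+ s. \<integral>\<^sup>+ \<omega>. w s * (h (Z \<omega>) ^ m * ennreal (exp (- (\<tau> + s) * Z \<omega>))) \<partial>P \<partial>lborel)"
      by (rule Fubini'[symmetric]) measurable
    also have "\<dots> = (\<integral>\<^sup>+ s. w s * (\<integral>\<^sup>+ \<omega>. h (Z \<omega>) ^ m * ennreal (exp (- (\<tau> + s) * Z \<omega>)) \<partial>P) \<partial>lborel)"
      by (intro nn_integral_cong nn_integral_cmult) measurable
    finally show ?thesis .
  qed
  show ?case
    unfolding h_def[symmetric] repr[OF M.prob_space_axioms X_meas] repr[OF N.prob_space_axioms Y_meas]
  proof (rule nn_integral_mono)
    fix s
    show "w s * (\<integral>\<^sup>+ \<omega>. h (X \<omega>) ^ m * ennreal (exp (- (\<tau> + s) * X \<omega>)) \<partial>M)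
        \<le> w s * (\<integral>\<^sup>+ \<omega>. h (Y \<omega>) ^ m * ennreal (exp (- (\<tau> + s) * Y \<omega>)) \<partial>N)"
    \<comment> \<open>The induction hypothesis needs \<open>\<tau> + s\<close> to be nonnegative;
      for negative \<open>s\<close> the weight is zero.\<close>
    proof (cases "s < 0")
      case False
      then show ?thesis
        using Suc.IH[of "\<tau> + s"] Suc.prems by (intro mult_left_mono) (simp_all add: h_def)
    qed (simp add: w)
  qed
qed

text \<open>The coefficients \<open>t ^ m / fact m\<close> of the exponential series are
  nonnegative, so \<open>mixture_power_le\<close> with \<open>\<tau> = 0\<close> applies term by
  term. The finite mass of \<open>w\<close> makes \<open>enn2real\<close> faithful.\<close>

lemma exp_mixture_le:
  fixes w :: "real \<Rightarrow> ennreal"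
  assumes [measurable]: "w \<in> borel_measurable borel" and w: "\<And>s. s < 0 \<Longrightarrow> w s = 0"
    and fin: "(\<integral>\<^sup>+ s. w s \<partial>lborel) < \<infinity>" and t: "0 \<le> t"
  shows "(\<integral>\<^sup>+ \<omega>. ennreal (exp (t * enn2real (\<integral>\<^sup>+ s. w s * ennreal (exp (- s * X \<omega>)) \<partial>lborel))) \<partial>M)
    \<le> (\<integral>\<^sup>+ \<omega>. ennreal (exp (t * enn2real (\<integral>\<^sup>+ s. w s * ennreal (exp (- s * Y \<omega>)) \<partial>lborel))) \<partial>N)"
proof -
  define h where "h x = (\<integral>\<^sup>+ s. w s * ennreal (exp (- s * x)) \<partial>lborel)" for x
  have [measurable]: "h \<in> borel_measurable borel"
    unfolding h_def by measurable
  have h_fin: "h x < \<infinity>" if "0 \<le> x" for x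
  proof -
    have "h x \<le> (\<integral>\<^sup>+ s. w s \<partial>lborel)"
      unfolding h_def
    proof (rule nn_integral_mono)
      fix s
      show "w s * ennreal (exp (- s * x)) \<le> w s"
      proof (cases "s < 0")
        case False
        then have "ennreal (exp (- s * x)) \<le> 1"
          using that by simp
        then show ?thesis
          using mult_left_mono[of _ 1 "w s"] by simp
      qed (simp add: w)
    qed
    with fin show ?thesis
      by simp
  qed
  have series: "ennreal (exp (t * enn2real (h x))) = (\<Sum>m. ennreal (t ^ m / fact m) * h x ^ m)" if "0 \<le> x" for x
  proof -
    have "h x < \<infinity>"
      using that by (rule h_fin)
    then obtain r where r: "0 \<le> r" "h x = ennreal r"
      by (cases "h x" rule: ennreal_cases) auto
    have "(\<lambda>m. t ^ m / fact m * r ^ m) sums exp (t * r)"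
      using exp_converges[of "t * r"] by (simp add: power_mult_distrib divide_inverse mult_ac)
    then have "(\<Sum>m. ennreal (t ^ m / fact m * r ^ m)) = ennreal (exp (t * r))"
      using t r(1) by (intro suminf_ennreal_eq) auto
    moreover have "ennreal (t ^ m / fact m) * h x ^ m = ennreal (t ^ m / fact m * r ^ m)" for m
      unfolding r(2) ennreal_power[OF r(1)] using t r(1) by (intro ennreal_mult[symmetric]) auto
    ultimately show ?thesis
      by (simp only: r(2) enn2real_ennreal[OF r(1)])
  qed
  have expand: "(\<integral>\<^sup>+ \<omega>. ennreal (exp (t * enn2real (h (Z \<omega>)))) \<partial>P) =
      (\<Sum>m. ennreal (t ^ m / fact m) * (\<integral>\<^sup>+ \<omega>. h (Z \<omega>) ^ m \<partial>P))"
    if [measurable]: "Z \<in> borel_measurable P" and Z: "\<And>\<omega>. 0 \<le> Z \<omega>" for P :: "'c measure" and Z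
  proof -
    have "(\<integral>\<^sup>+ \<omega>. ennreal (exp (t * enn2real (h (Z \<omega>)))) \<partial>P) = (\<integral>\<^sup>+ \<omega>. (\<Sum>m. ennreal (t ^ m / fact m) * h (Z \<omega>) ^ m) \<partial>P)"
      by (simp only: series[OF Z])
    also have "\<dots> = (\<Sum>m. \<integral>\<^sup>+ \<omega>. ennreal (t ^ m / fact m) * h (Z \<omega>) ^ m \<partial>P)"
      by (rule nn_integral_suminf) measurable
    also have "\<dots> = (\<Sum>m. ennreal (t ^ m / fact m) * (\<integral>\<^sup>+ \<omega>. h (Z \<omega>) ^ m \<partial>P))"
      by (intro suminf_cong nn_integral_cmult) measurable
    finally show ?thesis .
  qed
  have "(\<integral>\<^sup>+ \<omega>. h (X \<omega>) ^ m \<partial>M) \<le> (\<integral>\<^sup>+ \<omega>. h (Y \<omega>) ^ m \<partial>N)" for m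
    using mixture_power_le[of w 0 m] w by (simp add: h_def)
  then show ?thesis
    unfolding h_def[symmetric] expand[OF X_meas X_nonneg] expand[OF Y_meas Y_nonneg]
    by (intro suminf_le mult_left_mono) auto
qed

text \<open>
  Truncating the Bernstein integral near \<open>0\<close> exhibits \<open>c x\<^sup>\<theta>\<close> as the increasing limit of \<open>g\<^sub>n = W\<^sub>n - h\<^sub>n\<close>,
  where \<open>h\<^sub>n\<close> is a mixture of exponentials of finite mass \<open>W\<^sub>n\<close>.
\<close>

lemma laplace_powr:
  assumes \<theta>: "0 < \<theta>" "\<theta> < 1" and t: "0 \<le> t"
  shows "(\<integral>\<^sup>+ \<omega>. ennreal (exp (- t * X \<omega> powr \<theta>)) \<partial>M) \<le> (\<integral>\<^sup>+ \<omega>. ennreal (exp (- t * Y \<omega> powr \<theta>)) \<partial>N)"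
proof -
  obtain c where c: "0 < c" and Bernstein: "\<And>x. 0 \<le> x \<Longrightarrow>
    (\<integral>\<^sup>+ s. ennreal (s powr (- 1 - \<theta>) * (1 - exp (- (s * x)))) * indicator {0<..} s \<partial>lborel) = ennreal (c * x powr \<theta>)"
    by (rule nn_integral_Bernstein_powr[OF \<theta>]) blast
  define w where "w n s = ennreal (s powr (- 1 - \<theta>)) * indicator {1 / real (Suc n)..} s" for n s
  have w_meas [measurable]: "w n \<in> borel_measurable borel" for n
    unfolding w_def by measurable
  have w_neg: "w n s = 0" if "s < 0" for n s
    using that by (auto simp: w_def indicator_def not_le intro: less_trans[of s 0])
  define W where "W n = enn2real (\<integral>\<^sup>+ s. w n s \<partial>lborel)" for n
  have W_fin: "(\<integral>\<^sup>+ s. w n s \<partial>lborel) < \<infinity>" for n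
  proof -
    have "(\<integral>\<^sup>+ s. w n s \<partial>lborel) = ennreal (- ((1 / real (Suc n)) powr (- 1 - \<theta> + 1)) / (- 1 - \<theta> + 1))"
      unfolding w_def using has_integral_powr_to_inf[of "- 1 - \<theta>" "1 / real (Suc n)"] \<theta>
      by (intro nn_integral_has_integral_lebesgue') auto
    then show ?thesis
      by simp
  qed
  have W: "(\<integral>\<^sup>+ s. w n s \<partial>lborel) = ennreal (W n)" for n
    using W_fin[of n] by (simp add: W_def)
  define h where "h n x = (\<integral>\<^sup>+ s. w n s * ennreal (exp (- s * x)) \<partial>lborel)" for n x
  define g where "g n x = (\<integral>\<^sup>+ s. w n s * ennreal (1 - exp (- s * x)) \<partial>lborel)" for n x
  have g_le: "g n x \<le> ennreal (c * x powr \<theta>)" if "0 \<le> x" for n x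
    unfolding g_def Bernstein[OF that, symmetric]
  proof (rule nn_integral_mono)
    fix s
    show "w n s * ennreal (1 - exp (- s * x)) \<le> ennreal (s powr (- 1 - \<theta>) * (1 - exp (- (s * x)))) * indicator {0<..} s"
    proof (cases "1 / real (Suc n) \<le> s")
      case True
      then have "0 < s"
        by (rule less_le_trans[rotated]) simp
      with True show ?thesis
        by (simp add: w_def ennreal_mult')
    qed (simp add: w_def)
  qed
  have hg: "h n x + g n x = ennreal (W n)" if "0 \<le> x" for n x
  proof -
    have "h n x + g n x = (\<integral>\<^sup>+ s. w n s * ennreal (exp (- s * x)) + w n s * ennreal (1 - exp (- s * x)) \<partial>lborel)"
      unfolding h_def g_def by (rule nn_integral_add[symmetric]) measurable
    also have "\<dots> = (\<integral>\<^sup>+ s. w n s \<partial>lborel)"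
    proof (rule nn_integral_cong)
      fix s
      show "w n s * ennreal (exp (- s * x)) + w n s * ennreal (1 - exp (- s * x)) = w n s"
      proof (cases "s < 0")
        case False
        then have "ennreal (exp (- s * x)) + ennreal (1 - exp (- s * x)) = 1"
          using that by (subst ennreal_plus[symmetric]) auto
        then show ?thesis
          by (metis distrib_left mult.right_neutral)
      qed (simp add: w_neg)
    qed
    finally show ?thesis
      by (simp add: W)
  qed
  \<comment> \<open>By \<open>h n x + g n x = W n\<close>, the decaying exponential of
    \<open>g\<close> is a positive constant times a growing exponential of \<open>h\<close>, the
    form that \<open>exp_mixture_le\<close> compares.\<close>
  have exp_g: "exp (- (t / c) * enn2real (g n x)) = exp (- (t / c) * W n) * exp (t / c * enn2real (h n x))" if x: "0 \<le> x" for n x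
  proof -
    have "h n x < \<infinity>" "g n x < \<infinity>"
      using hg[OF x, of n] by (auto simp: less_top[symmetric])
    then have "enn2real (h n x) + enn2real (g n x) = W n"
      using hg[OF x, of n] by (simp add: W_def enn2real_plus[symmetric])
    then have W_eq: "W n = enn2real (h n x) + enn2real (g n x)" ..
    show ?thesis
      unfolding exp_add[symmetric] W_eq by (simp add: algebra_simps)
  qed
  have g_lim: "(\<lambda>n. enn2real (g n x)) \<longlonglongrightarrow> c * x powr \<theta>" if x: "0 \<le> x" for x
  proof -
    have "(\<lambda>n. g n x) \<longlonglongrightarrow> (\<integral>\<^sup>+ s. ennreal (s powr (- 1 - \<theta>) * (1 - exp (- (s * x)))) * indicator {0<..} s \<partial>lborel)"
      unfolding g_def
    proof (rule nn_integral_LIMSEQ)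
      have "w m s \<le> w n s" if "m \<le> n" for m n s
      proof -
        have "1 / real (Suc n) \<le> 1 / real (Suc m)"
          using that by (intro divide_left_mono) auto
        then show ?thesis
          by (auto simp: w_def indicator_def)
      qed
      then show "incseq (\<lambda>n s. w n s * ennreal (1 - exp (- s * x)))"
        by (auto simp: incseq_def le_fun_def intro!: mult_right_mono)
      fix s
      show "(\<lambda>n. w n s * ennreal (1 - exp (- s * x))) \<longlonglongrightarrow>
          ennreal (s powr (- 1 - \<theta>) * (1 - exp (- (s * x)))) * indicator {0<..} s"
      proof (cases "0 < s")
        case True
        obtain n0 where n0: "1 / real (Suc n0) < s"
          using nat_approx_posE[OF True] .
        have "w n s * ennreal (1 - exp (- s * x)) = ennreal (s powr (- 1 - \<theta>) * (1 - exp (- (s * x)))) * indicator {0<..} s"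
          if "n0 \<le> n" for n
        proof -
          have "1 / real (Suc n) \<le> 1 / real (Suc n0)"
            using that by (intro divide_left_mono) auto
          then have "1 / real (Suc n) \<le> s"
            using n0 by linarith
          then show ?thesis
            using True by (simp add: w_def ennreal_mult')
        qed
        then show ?thesis
          by (intro tendsto_eventually) (auto simp: eventually_sequentially)
      next
        case False
        then have "w n s = 0" for n
          by (auto simp: w_def indicator_def not_le intro: le_less_trans[of s 0])
        with False show ?thesis
          by simp
      qed
    qed measurable
    then show ?thesis
      unfolding Bernstein[OF x] by (rule tendsto_enn2real) (use c in simp_all)
  qed
  have [measurable]: "g n \<in> borel_measurable borel" for n
    unfolding g_def by measurable
  \<comment> \<open>A limit is taken on the side of \<open>Y\<close> only; for \<open>X\<close> the
    bound \<open>g_le\<close> suffices. The factor \<open>t / c\<close> compensates the Bernstein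
    constant \<open>c\<close>.\<close>
  have "(\<lambda>n. \<integral>\<^sup>+ \<omega>. ennreal (exp (- (t / c) * enn2real (g n (Y \<omega>)))) \<partial>N)
      \<longlonglongrightarrow> (\<integral>\<^sup>+ \<omega>. ennreal (exp (- (t / c) * (c * Y \<omega> powr \<theta>))) \<partial>N)"
  proof (rule nn_integral_dominated_convergence[where w="\<lambda>_. 1"])
    show "AE \<omega> in N. ennreal (exp (- (t / c) * enn2real (g n (Y \<omega>)))) \<le> 1" for n
      using t c by simp
    show "AE \<omega> in N. (\<lambda>n. ennreal (exp (- (t / c) * enn2real (g n (Y \<omega>))))) \<longlonglongrightarrow> ennreal (exp (- (t / c) * (c * Y \<omega> powr \<theta>)))"
      by (intro always_eventually allI tendsto_ennrealI tendsto_exp tendsto_mult tendsto_const g_lim Y_nonneg)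
  qed (simp_all add: N.emeasure_space_1)
  moreover have "(\<integral>\<^sup>+ \<omega>. ennreal (exp (- t * X \<omega> powr \<theta>)) \<partial>M) \<le> (\<integral>\<^sup>+ \<omega>. ennreal (exp (- (t / c) * enn2real (g n (Y \<omega>)))) \<partial>N)" for n
  proof -
    have "(\<integral>\<^sup>+ \<omega>. ennreal (exp (- t * X \<omega> powr \<theta>)) \<partial>M) \<le> (\<integral>\<^sup>+ \<omega>. ennreal (exp (- (t / c) * enn2real (g n (X \<omega>)))) \<partial>M)"
    proof (intro nn_integral_mono ennreal_leI)
      fix \<omega>
      have "enn2real (g n (X \<omega>)) \<le> c * X \<omega> powr \<theta>"
        using enn2real_mono[OF g_le[OF X_nonneg, of n \<omega>]] c by simp
      then have "t / c * enn2real (g n (X \<omega>)) \<le> t / c * (c * X \<omega> powr \<theta>)"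
        using t c by (intro mult_left_mono) auto
      then show "exp (- t * X \<omega> powr \<theta>) \<le> exp (- (t / c) * enn2real (g n (X \<omega>)))"
        using c by simp
    qed
    also have "\<dots> = ennreal (exp (- (t / c) * W n)) * (\<integral>\<^sup>+ \<omega>. ennreal (exp (t / c * enn2real (h n (X \<omega>)))) \<partial>M)"
      unfolding exp_g[OF X_nonneg] h_def by (subst nn_integral_cmult[symmetric]) (simp_all add: ennreal_mult')
    also have "\<dots> \<le> ennreal (exp (- (t / c) * W n)) * (\<integral>\<^sup>+ \<omega>. ennreal (exp (t / c * enn2real (h n (Y \<omega>)))) \<partial>N)"
      unfolding h_def using t c W_fin by (intro mult_left_mono exp_mixture_le w_meas w_neg) auto
    also have "\<dots> = (\<integral>\<^sup>+ \<omega>. ennreal (exp (- (t / c) * enn2real (g n (Y \<omega>)))) \<partial>N)"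
      unfolding exp_g[OF Y_nonneg] h_def by (subst nn_integral_cmult[symmetric]) (simp_all add: ennreal_mult')
    finally show ?thesis .
  qed
  ultimately have "(\<integral>\<^sup>+ \<omega>. ennreal (exp (- t * X \<omega> powr \<theta>)) \<partial>M) \<le> (\<integral>\<^sup>+ \<omega>. ennreal (exp (- (t / c) * (c * Y \<omega> powr \<theta>))) \<partial>N)"
    by (intro LIMSEQ_le_const) auto
  then show ?thesis
    using c by simp
qed

text \<open>The Bernstein representation covers \<open>0 < \<theta> < 1\<close>. At
  \<open>\<theta> = 0\<close> both transforms equal \<open>exp (- t)\<close> by almost sure
  positivity, and at \<open>\<theta> = 1\<close> the claim is the assumption.\<close>

lemma laplace_dominated_powr:
  assumes \<theta>: "0 \<le> \<theta>" "\<theta> \<le> 1"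
  shows "laplace_dominated M N (\<lambda>\<omega>. X \<omega> powr \<theta>) (\<lambda>\<omega>. Y \<omega> powr \<theta>)"
proof
  show "AE \<omega> in M. 0 < X \<omega> powr \<theta>" "AE \<omega> in N. 0 < Y \<omega> powr \<theta>"
    using X_pos Y_pos by (auto elim!: eventually_mono)
  fix t :: real assume t: "0 \<le> t"
  consider "\<theta> = 0" | "0 < \<theta>" "\<theta> < 1" | "\<theta> = 1"
    using \<theta> by linarith
  then show "(\<integral>\<^sup>+ \<omega>. ennreal (exp (- t * X \<omega> powr \<theta>)) \<partial>M) \<le> (\<integral>\<^sup>+ \<omega>. ennreal (exp (- t * Y \<omega> powr \<theta>)) \<partial>N)"
  proof cases
    case 1
    have "(\<integral>\<^sup>+ \<omega>. ennreal (exp (- t * X \<omega> powr \<theta>)) \<partial>M) = (\<integral>\<^sup>+ \<omega>. ennreal (exp (- t)) \<partial>M)"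
      using X_pos by (intro nn_integral_cong_AE, eventually_elim) (simp add: 1)
    also have "\<dots> = (\<integral>\<^sup>+ \<omega>. ennreal (exp (- t)) \<partial>N)"
      by (simp add: M.emeasure_space_1 N.emeasure_space_1)
    also have "\<dots> = (\<integral>\<^sup>+ \<omega>. ennreal (exp (- t * Y \<omega> powr \<theta>)) \<partial>N)"
      using Y_pos by (intro nn_integral_cong_AE, eventually_elim) (simp add: 1)
    finally show ?thesis
      by simp
  next
    case 2
    then show ?thesis
      using t by (rule laplace_powr)
  next
    case 3
    then show ?thesis
      using laplace[OF t] X_nonneg Y_nonneg by (simp add: abs_of_nonneg)
  qed
qed simp_all

end

section \<open>The comparison theorem\<close>

lemma power_sum_pos:
  assumes "x \<noteq> 0"
  shows "0 < power_sum p x"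
proof -
  obtain i where "x $ i \<noteq> 0"
    using assms by (auto simp: vec_eq_iff)
  then have "0 < \<bar>x $ i\<bar> powr p"
    by simp
  also have "\<dots> \<le> power_sum p x"
    by (rule member_le_sum) simp_all
  finally show ?thesis .
qed

lemma lp_norm_powr: "lp_norm p x powr e = power_sum p x powr (e / p)"
  by (simp add: lp_norm_def powr_powr)

theorem corollary21:
  fixes E :: "(real ^ 'n) set"
    and M :: "'v measure" and G :: "'v \<Rightarrow> real ^ 'n"
    and N :: "'w measure" and H :: "'w \<Rightarrow> real ^ 'k"
    and p :: real
  assumes E: "subspace E" "dim E = CARD('k)"
    and G: "std_gaussian_on M E G"
    and H: "std_gaussian_on N (UNIV :: (real ^ 'k) set) H"
    and p: "2 \<le> p"
  shows "(\<forall>\<theta> t :: real. 0 \<le> \<theta> \<and> \<theta> \<le> 1 \<and> 0 \<le> t \<longrightarrow>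
            (\<integral>\<^sup>+ \<omega>. ennreal (exp (- t * lp_norm p (G \<omega>) powr (\<theta> * p))) \<partial>M)
            \<le> (\<integral>\<^sup>+ \<omega>. ennreal (exp (- t * sqrt (real CARD('k) / real CARD('n)) powr (\<theta> * (p - 2))
                                    * lp_norm p (H \<omega>) powr (\<theta> * p))) \<partial>N))
       \<and> (\<forall>\<beta> :: real. 0 \<le> \<beta> \<and> \<beta> \<le> p \<longrightarrow>
            (\<integral>\<^sup>+ \<omega>. ennreal (lp_norm p (G \<omega>) powr \<beta>) \<partial>M)
            \<ge> ennreal ((real CARD('k) / real CARD('n)) powr (\<beta> * (1 / 2 - 1 / p)))
                * (\<integral>\<^sup>+ \<omega>. ennreal (lp_norm p (H \<omega>) powr \<beta>) \<partial>N))
       \<and> (\<forall>\<alpha> :: real. 0 \<le> \<alpha> \<and> \<alpha> < real CARD('k) \<longrightarrow>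
            (\<integral>\<^sup>+ \<omega>. ennreal (lp_norm p (G \<omega>) powr (- \<alpha>)) \<partial>M)
            \<le> ennreal ((real CARD('n) / real CARD('k)) powr (\<alpha> * (1 / 2 - 1 / p)))
                * (\<integral>\<^sup>+ \<omega>. ennreal (lp_norm p (H \<omega>) powr (- \<alpha>)) \<partial>N))"
proof -
  let ?r = "real CARD('k) / real CARD('n)"
  let ?q = "(p - 2) / 2"
  let ?X = "\<lambda>\<omega>. power_sum p (G \<omega>)"
  \<comment> \<open>As \<open>?q\<close> is half of \<open>p - 2\<close>, the factor
    \<open>?r powr ?q\<close> is \<open>sqrt ?r powr (p - 2)\<close>.\<close>
  let ?Y = "\<lambda>\<omega>. ?r powr ?q * power_sum p (H \<omega>)"
  have [measurable]: "G \<in> borel_measurable M" "H \<in> borel_measurable N"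
    using G H by (simp_all add: std_gaussian_on_def)
  have r: "0 < ?r"
    by simp
  interpret M: prob_space M
    using G by (simp add: std_gaussian_on_def)
  interpret N: prob_space N
    using H by (simp add: std_gaussian_on_def)
  interpret laplace_dominated M N ?X ?Y
  proof
    show "AE \<omega> in M. 0 < ?X \<omega>"
      using std_gaussian_on_nonzero[OF G E(2)] by eventually_elim (rule power_sum_pos)
    have "AE \<omega> in N. H \<omega> \<noteq> 0"
      by (rule std_gaussian_on_nonzero[OF H, where 'm='k]) simp
    then show "AE \<omega> in N. 0 < ?Y \<omega>"
      by eventually_elim (simp add: power_sum_pos)
    show "(\<integral>\<^sup>+ \<omega>. ennreal (exp (- t * ?X \<omega>)) \<partial>M) \<le> (\<integral>\<^sup>+ \<omega>. ennreal (exp (- t * ?Y \<omega>)) \<partial>N)" if "0 \<le> t" for t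
      by (rule std_gaussian_on_laplace_comparison[OF G E(2) H p that])
    show "?X \<in> borel_measurable M" "?Y \<in> borel_measurable N"
      by measurable
    show "0 \<le> ?X \<omega>" "0 \<le> ?Y \<omega>'" for \<omega> \<omega>'
      by (simp_all add: sum_nonneg)
  qed
  have X_powr: "?X \<omega> powr e = lp_norm p (G \<omega>) powr (e * p)" for \<omega> e
    using p by (simp add: lp_norm_powr)
  have Y_powr: "?Y \<omega> powr e = ?r powr (?q * e) * lp_norm p (H \<omega>) powr (e * p)" for \<omega> e
    using p by (simp add: lp_norm_powr powr_mult powr_powr)
  show ?thesis
  proof (intro conjI allI impI)
    fix \<theta> t :: real assume *: "0 \<le> \<theta> \<and> \<theta> \<le> 1 \<and> 0 \<le> t"
    \<comment> \<open>The powered pair is again dominated, and its Laplace inequality at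
      \<open>t\<close> is the claim.\<close>
    interpret D: laplace_dominated M N "\<lambda>\<omega>. ?X \<omega> powr \<theta>" "\<lambda>\<omega>. ?Y \<omega> powr \<theta>"
      using * by (intro laplace_dominated_powr) auto
    have "sqrt ?r powr (\<theta> * (p - 2)) = ?r powr (?q * \<theta>)"
      using r by (simp add: powr_half_sqrt[symmetric] powr_powr mult.commute)
    then show "(\<integral>\<^sup>+ \<omega>. ennreal (exp (- t * lp_norm p (G \<omega>) powr (\<theta> * p))) \<partial>M)
        \<le> (\<integral>\<^sup>+ \<omega>. ennreal (exp (- t * sqrt ?r powr (\<theta> * (p - 2)) * lp_norm p (H \<omega>) powr (\<theta> * p))) \<partial>N)"
      using D.laplace[of t] * unfolding X_powr Y_powr by (simp only: mult.assoc)
  next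
    fix \<beta> :: real assume *: "0 \<le> \<beta> \<and> \<beta> \<le> p"
    \<comment> \<open>With exponent \<open>\<beta> / p\<close>, which is at most one, the power sums
      become \<open>\<beta>\<close>-th powers of the norms, and \<open>mean_ge\<close> compares
      their means.\<close>
    interpret D: laplace_dominated M N "\<lambda>\<omega>. ?X \<omega> powr (\<beta> / p)" "\<lambda>\<omega>. ?Y \<omega> powr (\<beta> / p)"
      using * p by (intro laplace_dominated_powr) auto
    have "?q * (\<beta> / p) = \<beta> * (1 / 2 - 1 / p)" "\<beta> / p * p = \<beta>"
      using p by (simp_all add: field_simps)
    then have "(\<integral>\<^sup>+ \<omega>. ennreal (?r powr (\<beta> * (1 / 2 - 1 / p)) * lp_norm p (H \<omega>) powr \<beta>) \<partial>N)
        \<le> (\<integral>\<^sup>+ \<omega>. ennreal (lp_norm p (G \<omega>) powr \<beta>) \<partial>M)"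
      using D.mean_ge unfolding X_powr Y_powr by (simp only:)
    then show "ennreal (?r powr (\<beta> * (1 / 2 - 1 / p))) * (\<integral>\<^sup>+ \<omega>. ennreal (lp_norm p (H \<omega>) powr \<beta>) \<partial>N)
        \<le> (\<integral>\<^sup>+ \<omega>. ennreal (lp_norm p (G \<omega>) powr \<beta>) \<partial>M)"
      by (subst nn_integral_cmult[symmetric]) (simp_all add: lp_norm_powr ennreal_mult')
  next
    fix \<alpha> :: real assume *: "0 \<le> \<alpha> \<and> \<alpha> < real CARD('k)"
    \<comment> \<open>The negative moment of order \<open>\<alpha> / p\<close> of the power sums is
      that of order \<open>\<alpha>\<close> of the norms; the negative exponent inverts the ratio
      \<open>?r\<close>.\<close>
    have "- (\<alpha> / p) * p = - \<alpha>"
      using p by simp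
    moreover have "?r powr (?q * - (\<alpha> / p)) = (real CARD('n) / real CARD('k)) powr (\<alpha> * (1 / 2 - 1 / p))"
    proof -
      have "?q * - (\<alpha> / p) = - (\<alpha> * (1 / 2 - 1 / p))"
        using p by (simp add: field_simps)
      then show ?thesis
        by (simp only: powr_minus) (simp add: powr_divide field_simps)
    qed
    ultimately have "(\<integral>\<^sup>+ \<omega>. ennreal (lp_norm p (G \<omega>) powr (- \<alpha>)) \<partial>M) \<le>
        (\<integral>\<^sup>+ \<omega>. ennreal ((real CARD('n) / real CARD('k)) powr (\<alpha> * (1 / 2 - 1 / p)) * lp_norm p (H \<omega>) powr (- \<alpha>)) \<partial>N)"
      using negative_moment_le[of "\<alpha> / p"] * p unfolding X_powr Y_powr by simp
    then show "(\<integral>\<^sup>+ \<omega>. ennreal (lp_norm p (G \<omega>) powr (- \<alpha>)) \<partial>M) \<le>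
        ennreal ((real CARD('n) / real CARD('k)) powr (\<alpha> * (1 / 2 - 1 / p))) * (\<integral>\<^sup>+ \<omega>. ennreal (lp_norm p (H \<omega>) powr (- \<alpha>)) \<partial>N)"
      by (subst nn_integral_cmult[symmetric]) (simp_all add: lp_norm_powr ennreal_mult')
  qed
qed

end
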